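(* Let $F$ be a (possibly infinite) field of characteristic $2$ with more than $2$ elements, and let $m$ be a positive integer. Let $G_{m,F} := \mathrm{SL}(2,F) \ltimes \mathrm{M}(2 \times m, F)$, where $\mathrm{SL}(2,F)$ acts on the additive group of $\mathrm{M}(2 \times m,F)$ by matrix multiplication from the left. If $m \geq 2$ then $\omega(G_{m,F}) = 3 + \omega(\mathrm{SL}(2,F))$.
   Context: For a group $G$, $\omega(G)$ denotes the number of orbits of the natural action of the automorphism group $\mathrm{Aut}(G)$ (all abstract group automorphisms) on $G$. When there are infinitely many orbits, $\omega(G)$ is understood as a cardinal number. $\mathrm{M}(2 \times m,F)$ is the $F$-vector space of $2 \times m$ matrices with entries in $F$, and $\mathrm{SL}(2,F)$ is the group of $2\times 2$ matrices over $F$ of determinant $1$. *)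

theory Defs
  imports
    "HOL-Analysis.Determinants"
    "HOL-Algebra.Bij"
    "HOL-Algebra.Group_Action"
begin

unbundle cardinal_syntax

definition aut_orbits :: "('g, 'b) monoid_scheme \<Rightarrow> 'g set set" where
  "aut_orbits G = orbits (AutoGroup G) (carrier G) (\<lambda>\<alpha>. \<alpha>)"

text \<open>A cardinal is represented by a well-order; equality of cardinals is \<open>=o\<close>, their sum \<open>+c\<close>.\<close>

definition aut_orbit_number :: "('g, 'b) monoid_scheme \<Rightarrow> 'g set rel" (\<open>\<omega>\<close>) where
  "\<omega> G = |aut_orbits G|"

definition SL2 :: "('a::field ^ 2 ^ 2) monoid" where
  "SL2 = \<lparr>carrier = {A. det A = 1}, mult = (**), one = mat 1\<rparr>"

definition additive_group :: "'v::ab_group_add monoid" where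
  "additive_group = \<lparr>carrier = UNIV, mult = (+), one = 0\<rparr>"

definition semidirect_product ::
    "('h, 'b) monoid_scheme \<Rightarrow> ('n, 'c) monoid_scheme \<Rightarrow> ('h \<Rightarrow> 'n \<Rightarrow> 'n) \<Rightarrow> ('h \<times> 'n) monoid" where
  "semidirect_product H N \<phi> =
    \<lparr>carrier = carrier H \<times> carrier N,
     mult = (\<lambda>(h, n) (h', n'). (h \<otimes>\<^bsub>H\<^esub> h', n \<otimes>\<^bsub>N\<^esub> \<phi> h n')),
     one = (\<one>\<^bsub>H\<^esub>, \<one>\<^bsub>N\<^esub>)\<rparr>"

text \<open>
  The type \<^typ>\<open>'a ^ 'm ^ 2\<close> is the type of matrices with 2 rows and \<open>CARD('m)\<close> columns.
\<close>

definition SL2_semidirect_matrices :: "(('a::field ^ 2 ^ 2) \<times> ('a ^ 'm::finite ^ 2)) monoid" where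
  "SL2_semidirect_matrices = semidirect_product SL2 additive_group (**)"


lemma group_SL2: "group (SL2 :: ('a::field ^ 2 ^ 2) monoid)"
proof (rule groupI)
  fix A :: "'a ^ 2 ^ 2"
  assume "A \<in> carrier SL2"
  then have A: "det A = 1"
    by (simp add: SL2_def)
  then have "invertible A"
    by (simp add: invertible_det_nz)
  then obtain B where B: "A ** B = mat 1" "B ** A = mat 1"
    by (auto simp: invertible_def)
  have "det B = det (B ** A)"
    by (simp add: det_mul A)
  with B show "\<exists>B\<in>carrier SL2. B \<otimes>\<^bsub>SL2\<^esub> A = \<one>\<^bsub>SL2\<^esub>"
    by (auto simp: SL2_def)
qed (auto simp: SL2_def det_mul matrix_mul_assoc)

lemma group_additive_group: "group (additive_group :: 'v::ab_group_add monoid)"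
  by (rule groupI) (auto simp: additive_group_def add.assoc intro: exI[of _ "- x" for x])

lemma group_semidirect_product:
  assumes "group H" "group N"
    and hom: "\<And>h. h \<in> carrier H \<Longrightarrow> \<phi> h \<in> hom N N"
    and one: "\<And>n. n \<in> carrier N \<Longrightarrow> \<phi> \<one>\<^bsub>H\<^esub> n = n"
    and mult: "\<And>h h' n. h \<in> carrier H \<Longrightarrow> h' \<in> carrier H \<Longrightarrow> n \<in> carrier N \<Longrightarrow>
      \<phi> (h \<otimes>\<^bsub>H\<^esub> h') n = \<phi> h (\<phi> h' n)"
  shows "group (semidirect_product H N \<phi>)"
proof -
  interpret H: group H by fact
  interpret N: group N by fact
  have closed [simp]: "\<phi> h n \<in> carrier N" if "h \<in> carrier H" "n \<in> carrier N" for h n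
    using hom that by (auto simp: hom_def)
  have dist: "\<phi> h (n \<otimes>\<^bsub>N\<^esub> n') = \<phi> h n \<otimes>\<^bsub>N\<^esub> \<phi> h n'"
    if "h \<in> carrier H" "n \<in> carrier N" "n' \<in> carrier N" for h n n'
    using hom that by (auto simp: hom_def)
  show ?thesis
  proof (rule groupI)
    fix x assume "x \<in> carrier (semidirect_product H N \<phi>)"
    then obtain h n where x: "x = (h, n)" and h: "h \<in> carrier H" and n: "n \<in> carrier N"
      by (auto simp: semidirect_product_def)
    let ?y = "(inv\<^bsub>H\<^esub> h, inv\<^bsub>N\<^esub> (\<phi> (inv\<^bsub>H\<^esub> h) n))"
    have "?y \<in> carrier (semidirect_product H N \<phi>)"
      and "?y \<otimes>\<^bsub>semidirect_product H N \<phi>\<^esub> x = \<one>\<^bsub>semidirect_product H N \<phi>\<^esub>"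
      using h n by (auto simp: x semidirect_product_def)
    then show "\<exists>y\<in>carrier (semidirect_product H N \<phi>).
        y \<otimes>\<^bsub>semidirect_product H N \<phi>\<^esub> x = \<one>\<^bsub>semidirect_product H N \<phi>\<^esub>"
      by blast
  qed (auto simp: semidirect_product_def one mult dist H.m_assoc N.m_assoc)
qed

lemma group_SL2_semidirect_matrices:
  "group (SL2_semidirect_matrices :: (('a::field ^ 2 ^ 2) \<times> ('a ^ 'm::finite ^ 2)) monoid)"
  unfolding SL2_semidirect_matrices_def
  by (rule group_semidirect_product[OF group_SL2 group_additive_group])
    (auto simp: hom_def additive_group_def SL2_def matrix_mul_assoc
      matrix_add_ldistrib)

lemma aut_orbits_eq: "aut_orbits G = {{\<alpha> x |\<alpha>. \<alpha> \<in> auto G} |x. x \<in> carrier G}"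
  by (simp add: aut_orbits_def orbits_def orbit_def AutoGroup_def)

lemma (in group) group_action_AutoGroup: "group_action (AutoGroup G) (carrier G) (\<lambda>\<alpha>. \<alpha>)"
  unfolding group_action_def group_hom_def group_hom_axioms_def
  using AutoGroup group_BijGroup[of "carrier G"]
  by (auto simp: hom_def AutoGroup_def BijGroup_def auto_def)

end

theory Submission
  imports Defs
begin

text \<open>
  Let \<open>N\<close> be the normal subgroup of pairs with first component \<open>1\<close>. It is characteristic, so
  automorphisms of \<open>G\<close> act on \<open>G / N = SL\<^sub>2\<close>; conversely, in characteristic 2 every automorphism of
  \<open>SL\<^sub>2\<close> is semilinear and hence lifts to \<open>G\<close>. So the orbits that meet the complement \<open>SL\<^sub>2\<close>
  correspond to the orbits of \<open>SL\<^sub>2\<close>. If \<open>A - 1\<close> is invertible, then \<open>(A, M)\<close> is conjugate to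
  \<open>(A, 0)\<close>. If \<open>A\<close> is a transvection, then either \<open>(A, M)\<close> is an involution conjugate to
  \<open>(A, 0)\<close>, or it has order 4, and all such elements form one orbit. The nontrivial elements of \<open>N\<close>
  fall into two orbits, according to the rank of \<open>M\<close>: rank 2 means that the centralizer of \<open>(1, M)\<close>
  is contained in \<open>N\<close>.
\<close>

section \<open>Two-by-two matrices in characteristic 2\<close>

lemma char2_simps:
  fixes x y :: "'a::field"
  assumes "CHAR('a) = 2"
  shows "x + x = 0" "x + (x + y) = y" "- x = x" "x - y = x + y" "(1::'a) + 1 = 0"
    "x + y = 0 \<longleftrightarrow> x = y" "(2::'a) = 0"
proof -
  show neg: "- x = x" for x :: 'a
    by (rule uminus_CHAR_2) fact
  show xx: "x + x = 0" for x :: 'a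
    using neg[of x] by (metis add.right_inverse)
  show "(1::'a) + 1 = 0"
    by (rule xx)
  then show "(2::'a) = 0"
    by simp
  show "x + (x + y) = y"
    by (simp add: xx flip: add.assoc)
  show "x - y = x + y"
    by (simp add: diff_conv_add_uminus neg del: add_uminus_conv_diff)
  show "x + y = 0 \<longleftrightarrow> x = y"
    by (simp add: add_eq_0_iff2 neg)
qed

definition mat2 :: "'a::zero \<Rightarrow> 'a \<Rightarrow> 'a \<Rightarrow> 'a \<Rightarrow> 'a ^ 2 ^ 2" where
  "mat2 a b c d = vector [vector [a, b], vector [c, d]]"

lemma mat2_nth [simp]:
  "mat2 a b c d $ 1 $ 1 = a" "mat2 a b c d $ 1 $ 2 = b"
  "mat2 a b c d $ 2 $ 1 = c" "mat2 a b c d $ 2 $ 2 = d"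
  by (simp_all add: mat2_def)

lemma mat2_eq_iff: "A = B \<longleftrightarrow> A $ 1 $ 1 = B $ 1 $ 1 \<and> A $ 1 $ 2 = B $ 1 $ 2 \<and>
    A $ 2 $ 1 = B $ 2 $ 1 \<and> A $ 2 $ 2 = B $ 2 $ 2" for A B :: "'a ^ 2 ^ 2"
  by (auto simp: vec_eq_iff forall_2)

lemma mat2_inject [simp]:
  "mat2 a b c d = mat2 a' b' c' d' \<longleftrightarrow> a = a' \<and> b = b' \<and> c = c' \<and> d = d'"
  by (simp add: mat2_eq_iff)

lemma mat2_cases: obtains a b c d where "A = mat2 a b c d"
  using that[of "A $ 1 $ 1" "A $ 1 $ 2" "A $ 2 $ 1" "A $ 2 $ 2"] by (simp add: mat2_eq_iff)

lemma mat2_mult [simp]: "mat2 a b c d ** mat2 a' b' c' d' =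
    mat2 (a * a' + b * c') (a * b' + b * d') (c * a' + d * c') (c * b' + d * d')"
  by (simp add: mat2_eq_iff matrix_matrix_mult_def sum_2)

lemma mat2_add [simp]:
  "mat2 a b c d + mat2 a' b' c' d' = mat2 (a + a') (b + b') (c + c') (d + d')"
  for a b c d :: "'a::monoid_add"
  by (simp add: mat2_eq_iff)

lemma mat_1_eq_mat2: "mat 1 = mat2 1 0 0 1"
  by (simp add: mat2_eq_iff mat_def)

lemma det_mat2 [simp]: "det (mat2 a b c d) = a * d - b * c"
  by (simp add: det_2)

lemma map_matrix_mat2 [simp]: "map_matrix f (mat2 a b c d) = mat2 (f a) (f b) (f c) (f d)"
  by (simp add: mat2_eq_iff)

lemma SL2_simps [simp]:
  "A \<in> carrier SL2 \<longleftrightarrow> det A = 1" "A \<otimes>\<^bsub>SL2\<^esub> B = A ** B" "\<one>\<^bsub>SL2\<^esub> = mat 1"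
  by (simp_all add: SL2_def)

text \<open>Adding the two diagonal equations of \<open>A ** A = mat 1\<close> gives (a + d)^2 = 0,
  hence \<open>d = a\<close>; what remains says (a + 1)^2 = b c. The parameter \<open>p\<close> is
  the diagonal entry of the nilpotent matrix A - 1.\<close>

lemma SL2_involution_form:
  fixes A :: "'a::field ^ 2 ^ 2"
  assumes "CHAR('a) = 2" and "det A = 1" and "A ** A = mat 1"
  shows "\<exists>p b c. A = mat2 (p + 1) b c (p + 1) \<and> p * p = b * c"
proof -
  note c2 = char2_simps[OF assms(1)]
  obtain a b c d where A: "A = mat2 a b c d" by (rule mat2_cases)
  have sq: "a * a + b * c = 1" "d * d + b * c = 1"
    using assms(3) by (simp_all add: A mat_1_eq_mat2 mult.commute add.commute)
  have "(a + d) * (a + d) = (a * a + b * c) + (d * d + b * c)"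
    by (simp add: algebra_simps c2)
  then have "(a + d) * (a + d) = 0"
    by (simp add: sq c2)
  then have "d = a"
    by (simp add: c2)
  moreover have "1 + a * a = b * c"
    using sq(1) by (metis c2(2) add.commute)
  then have "(1 + a) * (1 + a) = b * c"
    by (simp add: algebra_simps c2)
  ultimately show ?thesis
    using A by (intro exI[of _ "1 + a"] exI[of _ b] exI[of _ c]) (simp add: c2 add.commute)
qed

text \<open>
  In characteristic 2, two non-commuting involutions are transvections with distinct axes. If \<open>v\<close>
  spans the axis of \<open>Q\<close>, then both are elementary with respect to the basis \<open>(P - 1) v, v\<close>.
\<close>

lemma noncommuting_involutions_normal_form:
  fixes P Q :: "'a::field ^ 2 ^ 2"
  assumes char: "CHAR('a) = 2" and "det P = 1" "det Q = 1"
    and "P ** P = mat 1" "Q ** Q = mat 1" and nc: "P ** Q \<noteq> Q ** P"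
  obtains h h' y where "h ** h' = mat 1" "h' ** h = mat 1"
    "P ** h = h ** mat2 1 1 0 1" "Q ** h = h ** mat2 1 0 y 1"
proof -
  note c2 = char2_simps[OF char]
  obtain p b c where P: "P = mat2 (p + 1) b c (p + 1)" and p: "p * p = b * c"
    using SL2_involution_form[OF char] assms by blast
  obtain q r s where Q: "Q = mat2 (q + 1) r s (q + 1)" and q: "q * q = r * s"
    using SL2_involution_form[OF char] assms by blast
  \<comment> \<open>In characteristic 2 this is the trace of (P - 1)(Q - 1). It becomes the entry
    \<open>y\<close>.\<close>
  have D: "b * s + c * r \<noteq> 0"
  proof
    assume "b * s + c * r = 0"
    then have "b * s = c * r"
      by (simp add: c2)
    then have "P ** Q = Q ** P"
      by (simp add: P Q algebra_simps)
    with nc show False ..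
  qed
  \<comment> \<open>The vector (v1, v2) lies in the kernel of Q - 1. The last condition says that (P
    - 1) v and v are linearly independent, so that they can serve as the columns of
    \<open>h\<close>.\<close>
  obtain v1 v2 where v: "q * v1 = r * v2" "q * v2 = s * v1"
    and det: "b * (v2 * v2) + c * (v1 * v1) \<noteq> 0"
  proof (cases "r = 0")
    case False
    show ?thesis
    proof (rule that[of r q])
      have "b * (q * q) + c * (r * r) = r * (b * s + c * r)"
        by (simp add: q algebra_simps)
      then show "b * (q * q) + c * (r * r) \<noteq> 0"
        using D False by simp
    qed (simp_all add: q mult.commute)
  next
    case True
    with q have "q = 0"
      by simp
    with True D show ?thesis
      by (intro that[of 0 s]) auto
  qed
  define u1 where "u1 = p * v1 + b * v2"
  define u2 where "u2 = c * v1 + p * v2"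
  define h where "h = mat2 u1 v1 u2 v2"
  have "det h = b * (v2 * v2) + c * (v1 * v1)"
    unfolding h_def u1_def u2_def det_mat2 by (simp add: algebra_simps c2)
  then have "invertible h"
    using det by (simp add: invertible_det_nz)
  then obtain h' where h': "h ** h' = mat 1" "h' ** h = mat 1"
    by (auto simp: invertible_def)
  have "p * u1 + b * u2 = (p * p + b * c) * v1" "c * u1 + p * u2 = (p * p + b * c) * v2"
    unfolding u1_def u2_def by (simp_all add: algebra_simps c2)
  then have "p * u1 + b * u2 = 0" "c * u1 + p * u2 = 0"
    by (simp_all add: p c2)
  then have Ph: "P ** h = h ** mat2 1 1 0 1"
    by (simp add: P h_def algebra_simps c2) (simp add: u1_def u2_def algebra_simps)
  have "q * u1 + r * u2 = p * (q * v1 + r * v2) + b * (q * v2) + c * r * v1"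
    "s * u1 + q * u2 = p * (s * v1 + q * v2) + b * s * v2 + c * (q * v1)"
    unfolding u1_def u2_def by (simp_all add: algebra_simps)
  then have "q * u1 + r * u2 = v1 * (b * s + c * r)" "s * u1 + q * u2 = v2 * (b * s + c * r)"
    by (simp_all add: v c2 algebra_simps)
  then have "Q ** h = h ** mat2 1 0 (b * s + c * r) 1"
    by (simp add: Q h_def algebra_simps v c2)
  with that h' Ph show thesis by blast
qed

section \<open>Automorphisms of SL(2) in characteristic 2\<close>

definition field_aut :: "('a::field \<Rightarrow> 'a) \<Rightarrow> bool" where
  "field_aut \<sigma> \<longleftrightarrow> bij \<sigma> \<and> (\<forall>x y. \<sigma> (x + y) = \<sigma> x + \<sigma> y) \<and> (\<forall>x y. \<sigma> (x * y) = \<sigma> x * \<sigma> y)"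

lemma field_autD:
  assumes "field_aut \<sigma>"
  shows "bij \<sigma>" "\<sigma> (x + y) = \<sigma> x + \<sigma> y" "\<sigma> (x * y) = \<sigma> x * \<sigma> y" "\<sigma> 0 = 0" "\<sigma> 1 = 1"
proof -
  have add: "\<sigma> (x + y) = \<sigma> x + \<sigma> y" and mult: "\<sigma> (x * y) = \<sigma> x * \<sigma> y" for x y
    using assms by (simp_all add: field_aut_def)
  show "bij \<sigma>" "\<sigma> (x + y) = \<sigma> x + \<sigma> y" "\<sigma> (x * y) = \<sigma> x * \<sigma> y"
    using assms by (simp_all add: field_aut_def)
  show zero: "\<sigma> 0 = 0"
    using add[of 0 0] by (metis add.right_neutral add_left_cancel)
  have "\<sigma> 1 \<noteq> 0"
    using \<open>bij \<sigma>\<close> zero by (metis bij_pointE zero_neq_one)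
  then show "\<sigma> 1 = 1"
    using mult[of 1 1] by simp
qed

lemma map_matrix_add:
  "field_aut \<sigma> \<Longrightarrow> map_matrix \<sigma> (A + B) = map_matrix \<sigma> A + map_matrix \<sigma> B"
  by (simp add: vec_eq_iff field_autD)

lemma map_matrix_mult:
  fixes A :: "'a::field ^ 'n::finite ^ 'm::finite" and B :: "'a ^ 'k::finite ^ 'n"
  assumes "field_aut \<sigma>"
  shows "map_matrix \<sigma> (A ** B) = map_matrix \<sigma> A ** map_matrix \<sigma> B"
proof -
  have "\<sigma> (sum f S) = (\<Sum>i\<in>S. \<sigma> (f i))" for f and S :: "'n set"
    using sum_comp_morphism[of \<sigma> f S] assms by (simp add: field_autD comp_def)
  then show ?thesis
    by (simp add: vec_eq_iff matrix_matrix_mult_def field_autD(3)[OF assms])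
qed

text \<open>Commuting with the transvection leaves an upper triangular matrix with constant diagonal
  \<open>a\<close>. Since a^2 = 1 has only the root 1 in characteristic 2, nothing but the root
  group remains.\<close>

lemma centralizer_upper:
  fixes A :: "'a::field ^ 2 ^ 2"
  assumes "CHAR('a) = 2" "det A = 1" "A ** mat2 1 1 0 1 = mat2 1 1 0 1 ** A"
  shows "A = mat2 1 (A $ 1 $ 2) 0 1"
proof -
  note c2 = char2_simps[OF assms(1)]
  obtain a b c d where A: "A = mat2 a b c d" by (rule mat2_cases)
  have "c = 0" "d = a"
    using assms(3) by (auto simp: A)
  moreover from this have "a * a = 1"
    using assms(2) by (simp add: A c2)
  then have "(a + 1) * (a + 1) = 0"
    by (simp add: algebra_simps c2)
  then have "a = 1"
    by (simp add: c2)
  ultimately show ?thesis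
    by (simp add: A)
qed

text \<open>The transposed argument, with a general entry \<open>y\<close> because a normalized
  automorphism is known on \<open>mat2 1 0 1 1\<close> only up to this entry.\<close>

lemma centralizer_lower:
  fixes A :: "'a::field ^ 2 ^ 2"
  assumes "CHAR('a) = 2" "det A = 1" "A ** mat2 1 0 y 1 = mat2 1 0 y 1 ** A" "y \<noteq> 0"
  shows "A = mat2 1 0 (A $ 2 $ 1) 1"
proof -
  note c2 = char2_simps[OF assms(1)]
  obtain a b c d where A: "A = mat2 a b c d" by (rule mat2_cases)
  have "b = 0" "d = a"
    using assms(3,4) by (auto simp: A add.commute mult.commute)
  moreover from this have "a * a = 1"
    using assms(2) by (simp add: A c2)
  then have "(a + 1) * (a + 1) = 0"
    by (simp add: algebra_simps c2)
  then have "a = 1"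
    by (simp add: c2)
  ultimately show ?thesis
    by (simp add: A)
qed

text \<open>
  The centralizers of the two elementary matrices are the two root groups, so \<open>\<beta>\<close> induces additive
  maps \<open>f\<close> and \<open>g\<close> on these. The Weyl elements \<open>w(t) = e\<^sub>1\<^sub>2(t) e\<^sub>2\<^sub>1(1/t) e\<^sub>1\<^sub>2(t)\<close> yield
  \<open>g (1/t) = 1 / f t\<close>, and multiplicativity of \<open>f\<close> comes from \<open>diag(t, 1/t) = w(t) w(1)\<close>.
\<close>

lemma normalized_automorphism_SL2:
  fixes \<beta> :: "'a::field ^ 2 ^ 2 \<Rightarrow> 'a ^ 2 ^ 2"
  assumes char: "CHAR('a) = 2" and hom: "\<beta> \<in> hom SL2 SL2"
    and bij: "bij_betw \<beta> (carrier SL2) (carrier SL2)"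
    and up: "\<beta> (mat2 1 1 0 1) = mat2 1 1 0 1" and low: "\<beta> (mat2 1 0 1 1) = mat2 1 0 y 1"
  obtains \<sigma> where "field_aut \<sigma>" "\<And>A. det A = 1 \<Longrightarrow> \<beta> A = map_matrix \<sigma> A"
proof -
  note c2 = char2_simps[OF char]
  have mult: "\<beta> (A ** B) = \<beta> A ** \<beta> B" if "det A = 1" "det B = 1" for A B
    using hom_mult[OF hom] that by simp
  have det: "det (\<beta> A) = 1" if "det A = 1" for A
    using hom_in_carrier[OF hom] that by simp
  have inj: "A = B" if "\<beta> A = \<beta> B" "det A = 1" "det B = 1" for A B
    using bij that by (auto simp: bij_betw_def inj_on_def)
  have one: "\<beta> (mat2 1 0 0 1) = mat2 1 0 0 1"
    using hom_one[OF hom group_SL2 group_SL2] by (simp add: mat_1_eq_mat2)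
  have y: "y \<noteq> 0"
    using inj[of "mat2 1 0 1 1" "mat2 1 0 0 1"] one low by auto
  define f where "f t = \<beta> (mat2 1 t 0 1) $ 1 $ 2" for t
  define g where "g t = \<beta> (mat2 1 0 t 1) $ 2 $ 1" for t
  have f: "\<beta> (mat2 1 t 0 1) = mat2 1 (f t) 0 1" for t
    unfolding f_def
  proof (rule centralizer_upper[OF char])
    have "mat2 1 t 0 1 ** mat2 1 1 0 1 = mat2 1 1 0 1 ** mat2 1 t 0 1"
      by (simp add: add.commute)
    then show "\<beta> (mat2 1 t 0 1) ** mat2 1 1 0 1 = mat2 1 1 0 1 ** \<beta> (mat2 1 t 0 1)"
      by (metis mult up det_mat2 mult_1 diff_zero mult_zero_right)
  qed (simp add: det)
  have g: "\<beta> (mat2 1 0 t 1) = mat2 1 0 (g t) 1" for t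
    unfolding g_def
  proof (rule centralizer_lower[OF char _ _ y])
    have "mat2 1 0 t 1 ** mat2 1 0 1 1 = mat2 1 0 1 1 ** mat2 1 0 t 1"
      by (simp add: add.commute)
    then show "\<beta> (mat2 1 0 t 1) ** mat2 1 0 y 1 = mat2 1 0 y 1 ** \<beta> (mat2 1 0 t 1)"
      by (metis mult low det_mat2 mult_1 diff_zero mult_zero_left)
  qed (simp add: det)
  have f1: "f 1 = 1" and f0: "f 0 = 0" and g0: "g 0 = 0"
    using up one by (simp_all add: f_def g_def)
  have add: "f (s + t) = f s + f t" for s t
    using mult[of "mat2 1 s 0 1" "mat2 1 t 0 1"] by (simp add: f add.commute)
  have f_nz: "f t \<noteq> 0" if "t \<noteq> 0" for t
    using inj[of "mat2 1 t 0 1" "mat2 1 0 0 1"] that f[of t] one by auto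
  have bruhat: "\<beta> (mat2 1 s 0 1 ** mat2 1 0 t 1 ** mat2 1 u 0 1) =
      mat2 1 (f s) 0 1 ** mat2 1 0 (g t) 1 ** mat2 1 (f u) 0 1" for s t u
  proof -
    have "det (mat2 1 s 0 1 ** mat2 1 0 t 1) = 1"
      unfolding det_mul by simp
    then show ?thesis
      by (subst mult, assumption, simp, subst mult) (simp_all add: f g del: mat2_mult)
  qed
  have weyl: "mat2 1 t 0 1 ** mat2 1 0 (1 / t) 1 ** mat2 1 t 0 1 = mat2 0 t (1 / t) 0"
    if "t \<noteq> 0" for t :: 'a
    using that by (simp add: c2)
  \<comment> \<open>The Weyl element \<open>?w\<close> conjugates the upper root group to the lower
    one. Under \<open>\<beta>\<close> the first rows of this relation force the upper left entry of
    \<open>\<beta> ?w\<close> to vanish, and that entry is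
    \<open>1 + f t * g (1 / t)\<close>.\<close>
  have fg: "g (1 / t) = 1 / f t" if "t \<noteq> 0" for t
  proof -
    let ?w = "mat2 0 t (1 / t) 0" and ?z = "1 / (t * t)"
    have "?w ** mat2 1 1 0 1 = mat2 1 0 ?z 1 ** ?w"
      using that by simp
    then have "\<beta> ?w ** mat2 1 1 0 1 = mat2 1 0 (g ?z) 1 ** \<beta> ?w"
      using mult[of ?w "mat2 1 1 0 1"] mult[of "mat2 1 0 ?z 1" ?w] that
      by (simp add: c2 up g)
    moreover have "\<beta> ?w = mat2 1 (f t) 0 1 ** mat2 1 0 (g (1 / t)) 1 ** mat2 1 (f t) 0 1"
      using bruhat[of t "1 / t" t] weyl[OF that] by simp
    ultimately have "1 + f t * g (1 / t) = 0"
      by (simp add: algebra_simps)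
    then have "f t * g (1 / t) = 1"
      by (simp add: c2)
    then show ?thesis
      using f_nz[OF that] by (simp add: field_simps)
  qed
  have \<beta>_weyl: "\<beta> (mat2 0 t (1 / t) 0) = mat2 0 (f t) (1 / f t) 0" if "t \<noteq> 0" for t
    using bruhat[of t "1 / t" t] f_nz[OF that] unfolding weyl[OF that]
    by (simp add: fg[OF that] c2)
  have \<beta>_diag: "\<beta> (mat2 t 0 0 (1 / t)) = mat2 (f t) 0 0 (1 / f t)" if "t \<noteq> 0" for t
    using mult[of "mat2 0 t (1 / t) 0" "mat2 0 1 1 0"] \<beta>_weyl[OF that] \<beta>_weyl[of 1] that
    by (simp add: c2 f1)
  have times: "f (s * t) = f s * f t" for s t
  proof (cases "s = 0 \<or> t = 0")
    case False
    then show ?thesis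
      using mult[of "mat2 s 0 0 (1 / s)" "mat2 t 0 0 (1 / t)"] \<beta>_diag[of s] \<beta>_diag[of t]
        \<beta>_diag[of "s * t"] by simp
  qed (auto simp: f0)
  \<comment> \<open>Multiplicativity of \<open>f\<close> turns \<open>g (1 / t) = 1 / f t\<close>
    into equality of the two maps. In particular \<open>y = 1\<close>.\<close>
  have g_eq: "g t = f t" for t
  proof (cases "t = 0")
    case False
    then have "f t * f (1 / t) = 1"
      using times[of t "1 / t"] f1 by simp
    moreover have "g t = 1 / f (1 / t)"
      using fg[of "1 / t"] False by simp
    ultimately show ?thesis
      using f_nz[of "1 / t"] False by (simp add: eq_divide_eq) (metis mult_right_cancel)
  qed (simp add: f0 g0)
  have "inj f"
  proof (rule injI)
    show "s = t" if "f s = f t" for s t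
      using inj[of "mat2 1 s 0 1" "mat2 1 t 0 1"] that by (simp add: f)
  qed
  \<comment> \<open>A preimage of an upper elementary matrix commutes with
    \<open>mat2 1 1 0 1\<close>, because the images commute and \<open>\<beta>\<close> is injective.
    Hence it is upper elementary itself.\<close>
  moreover have "surj f"
    unfolding surj_def
  proof
    fix z
    have "mat2 1 z 0 1 \<in> \<beta> ` carrier SL2"
      using bij by (simp add: bij_betw_def)
    then obtain A where A: "mat2 1 z 0 1 = \<beta> A" "det A = 1"
      by auto
    have "\<beta> (A ** mat2 1 1 0 1) = \<beta> (mat2 1 1 0 1 ** A)"
      using mult[of A "mat2 1 1 0 1"] mult[of "mat2 1 1 0 1" A] A(2)
      by (simp add: up add.commute flip: A(1))
    then have "A ** mat2 1 1 0 1 = mat2 1 1 0 1 ** A"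
      using inj[of "A ** mat2 1 1 0 1" "mat2 1 1 0 1 ** A"] A(2) by (simp add: det_mul)
    then have "A = mat2 1 (A $ 1 $ 2) 0 1"
      using centralizer_upper[OF char A(2)] by blast
    then show "\<exists>x. z = f x"
      using A(1) f by (metis mat2_inject)
  qed
  ultimately have aut: "field_aut f"
    by (simp add: field_aut_def add times bij_def)
  \<comment> \<open>With a nonzero lower left entry \<open>c\<close>, the matrix is a product of
    elementary matrices with entries \<open>?s\<close>, \<open>c\<close>, \<open>?t\<close>, on
    which \<open>\<beta>\<close> is already known.\<close>
  have big_cell: "\<beta> (mat2 a b c d) = map_matrix f (mat2 a b c d)"
    if "det (mat2 a b c d) = 1" "c \<noteq> 0" for a b c d
  proof -
    let ?s = "(a + 1) / c" and ?t = "(d + 1) / c"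
    have bc: "b * c = a * d + 1"
      using that(1) by (simp add: c2(3,4)) (metis c2(2) add.commute)
    have "b * (c * c) = c + a * (c * d)"
      using arg_cong[OF bc, of "\<lambda>x. x * c"] by (simp add: algebra_simps)
    with bc have eq: "mat2 a b c d = mat2 1 ?s 0 1 ** mat2 1 0 c 1 ** mat2 1 ?t 0 1"
      using that(2) by (simp add: field_simps c2(1-6))
    show ?thesis
      unfolding eq bruhat map_matrix_mult[OF aut] map_matrix_mat2 g_eq f0 f1 ..
  qed
  have "\<beta> A = map_matrix f A" if "det A = 1" for A
  proof -
    obtain a b c d where A: "A = mat2 a b c d" by (rule mat2_cases)
    show ?thesis
    proof (cases "c = 0")
      case True
      then have "d \<noteq> 0"
        using that by (auto simp: A)
      \<comment> \<open>Multiplying an upper triangular matrix on the right by the involution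
        \<open>mat2 1 0 1 1\<close> moves it into the big cell, since its lower left entry becomes
        \<open>d\<close>.\<close>
      let ?B = "mat2 (a + b) b d d"
      have eq: "A = ?B ** mat2 1 0 1 1"
        using True by (simp add: A c2 add.assoc)
      have "det ?B = 1"
        using that True by (simp add: A algebra_simps)
      then show ?thesis
        unfolding eq using \<open>d \<noteq> 0\<close>
        by (subst mult)
          (simp_all add: big_cell g g_eq f0 f1 map_matrix_mult[OF aut] del: mat2_mult)
    qed (use big_cell that in \<open>auto simp: A\<close>)
  qed
  with aut that show thesis by blast
qed

text \<open>The elementary matrices \<open>?u\<close> and \<open>?l\<close> are non-commuting
  involutions, and so are their images. Conjugation by the matrix \<open>h\<close> that brings these
  images to elementary form reduces to the normalized case.\<close>

lemma automorphism_SL2_semilinear: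
  fixes \<beta> :: "'a::field ^ 2 ^ 2 \<Rightarrow> 'a ^ 2 ^ 2"
  assumes char: "CHAR('a) = 2" and auto: "\<beta> \<in> auto SL2"
  obtains h h' \<sigma> where "h ** h' = mat 1" "h' ** h = mat 1" "field_aut \<sigma>"
    "\<And>A. det A = 1 \<Longrightarrow> \<beta> A = h ** map_matrix \<sigma> A ** h'"
proof -
  have hom: "\<beta> \<in> hom SL2 SL2" and bij: "bij_betw \<beta> (carrier SL2) (carrier SL2)"
    using auto by (auto simp: auto_def Bij_def)
  have mult: "\<beta> (A ** B) = \<beta> A ** \<beta> B" if "det A = 1" "det B = 1" for A B
    using hom_mult[OF hom] that by simp
  have det: "det (\<beta> A) = 1" if "det A = 1" for A
    using hom_in_carrier[OF hom] that by simp
  have inj: "A = B" if "\<beta> A = \<beta> B" "det A = 1" "det B = 1" for A B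
    using bij that by (auto simp: bij_betw_def inj_on_def)
  have one: "\<beta> (mat 1) = mat 1"
    using hom_one[OF hom group_SL2 group_SL2] by simp
  note c2 = char2_simps[OF char]
  let ?u = "mat2 1 1 0 (1::'a)" and ?l = "mat2 1 0 1 (1::'a)"
  have "?u ** ?l \<noteq> ?l ** ?u"
    by (simp add: c2)
  then have nc: "\<beta> ?u ** \<beta> ?l \<noteq> \<beta> ?l ** \<beta> ?u"
    using inj[of "?u ** ?l" "?l ** ?u"] mult[of ?u ?l] mult[of ?l ?u]
    by (auto simp: det_mul simp del: mat2_mult)
  have "\<beta> ?u ** \<beta> ?u = mat 1" "\<beta> ?l ** \<beta> ?l = mat 1"
    using mult[of ?u ?u] mult[of ?l ?l] one by (simp_all add: c2 mat_1_eq_mat2)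
  from noncommuting_involutions_normal_form[OF char det det this nc]
  obtain h h' y where h: "h ** h' = mat 1" "h' ** h = mat 1"
    "\<beta> ?u ** h = h ** ?u" "\<beta> ?l ** h = h ** mat2 1 0 y 1"
    by auto
  have cancel: "h ** (h' ** X) = X" "h' ** (h ** X) = X" for X :: "'a ^ 2 ^ 2"
    by (simp_all add: matrix_mul_assoc h)
  have det_h: "det h' * det h = 1"
    by (metis det_I det_mul h(2))
  \<comment> \<open>The matrix \<open>h\<close> is only invertible, but conjugation by it still
    preserves SL(2).\<close>
  have det_conj: "det (h' ** A ** h) = det A" "det (h ** A ** h') = det A" for A
    using det_h by (simp_all add: det_mul mult.commute mult.left_commute)
  have conj_hom: "(\<lambda>A. h' ** \<beta> A ** h) \<in> hom SL2 SL2"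
    by (auto simp: hom_def det_conj det) (simp add: det mult cancel flip: matrix_mul_assoc)
  have "bij_betw (\<lambda>A. h' ** A ** h) (carrier SL2) (carrier SL2)"
    by (rule bij_betw_byWitness[where f' = "\<lambda>A. h ** A ** h'"])
      (auto simp: det_conj, auto simp: cancel h simp flip: matrix_mul_assoc)
  from bij_betw_trans[OF bij this]
  have conj_bij: "bij_betw (\<lambda>A. h' ** \<beta> A ** h) (carrier SL2) (carrier SL2)"
    by (simp add: comp_def)
  obtain \<sigma> where \<sigma>: "field_aut \<sigma>" "\<And>A. det A = 1 \<Longrightarrow> h' ** \<beta> A ** h = map_matrix \<sigma> A"
    by (rule normalized_automorphism_SL2[OF char conj_hom conj_bij, of y])
      (simp_all add: h(3,4) cancel flip: matrix_mul_assoc)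
  have "\<beta> A = h ** map_matrix \<sigma> A ** h'" if "det A = 1" for A
    by (simp add: \<sigma>(2)[OF that, symmetric]) (simp add: cancel h flip: matrix_mul_assoc)
  with that h(1,2) \<sigma>(1) show thesis by blast
qed

section \<open>Orbits under automorphisms\<close>

definition aut_equiv :: "('g, 'b) monoid_scheme \<Rightarrow> 'g \<Rightarrow> 'g \<Rightarrow> bool" where
  "aut_equiv G x y \<longleftrightarrow> (\<exists>\<alpha>\<in>auto G. \<alpha> x = y)"

lemma autoD:
  assumes "\<alpha> \<in> auto G"
  shows "\<alpha> \<in> hom G G" "bij_betw \<alpha> (carrier G) (carrier G)"
  using assms by (auto simp: auto_def Bij_def)

lemma aut_equiv_closed: "aut_equiv G x y \<Longrightarrow> x \<in> carrier G \<Longrightarrow> y \<in> carrier G"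
  by (auto simp: aut_equiv_def dest!: autoD(1) hom_in_carrier)

text \<open>Elements of \<open>auto G\<close> are extensional on the carrier. Restricting
  \<open>f\<close> allows automorphisms to be given by plain formulas.\<close>

lemma (in group) aut_equivI:
  assumes "f \<in> hom G G" "bij_betw f (carrier G) (carrier G)" "x \<in> carrier G"
  shows "aut_equiv G x (f x)"
proof -
  have "restrict f (carrier G) \<in> auto G"
    using assms by (auto simp: auto_def Bij_def hom_def Pi_iff)
  then show ?thesis
    using assms(3) unfolding aut_equiv_def by (intro bexI[of _ "restrict f (carrier G)"]) auto
qed

lemma (in group) aut_equiv_refl: "x \<in> carrier G \<Longrightarrow> aut_equiv G x x"
  using aut_equivI[of "\<lambda>x. x" x] by (simp add: hom_def bij_betw_def)

lemma (in group) aut_equiv_sym: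
  assumes "aut_equiv G x y" "x \<in> carrier G"
  shows "aut_equiv G y x"
proof -
  interpret act: group_action "AutoGroup G" "carrier G" "\<lambda>\<alpha>. \<alpha>"
    by (rule group_action_AutoGroup)
  interpret AG: group "AutoGroup G"
    by (rule AutoGroup)
  obtain \<alpha> where \<alpha>: "\<alpha> \<in> carrier (AutoGroup G)" "\<alpha> x = y"
    using assms by (auto simp: aut_equiv_def AutoGroup_def)
  with act.orbit_sym_aux[OF _ assms(2)] AG.inv_closed[of \<alpha>] show ?thesis
    unfolding aut_equiv_def by (auto simp: AutoGroup_def)
qed

lemma (in group) aut_equiv_trans:
  assumes "aut_equiv G x y" "aut_equiv G y z" "x \<in> carrier G"
  shows "aut_equiv G x z"
proof -
  obtain \<alpha> \<beta> where \<alpha>: "\<alpha> \<in> auto G" "\<alpha> x = y" and \<beta>: "\<beta> \<in> auto G" "\<beta> y = z"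
    using assms by (auto simp: aut_equiv_def)
  have "\<beta> \<circ> \<alpha> \<in> hom G G" "bij_betw (\<beta> \<circ> \<alpha>) (carrier G) (carrier G)"
    using autoD[OF \<alpha>(1)] autoD[OF \<beta>(1)] by (auto intro: bij_betw_trans simp: hom_def Pi_iff)
  from aut_equivI[OF this assms(3)] show ?thesis
    by (simp add: \<alpha> \<beta>)
qed

definition aut_orbit :: "('g, 'b) monoid_scheme \<Rightarrow> 'g \<Rightarrow> 'g set" where
  "aut_orbit G x = {y. aut_equiv G x y}"

lemma aut_orbits_image: "aut_orbits G = aut_orbit G ` carrier G"
  by (auto simp: aut_orbits_eq aut_orbit_def aut_equiv_def)

lemma (in group) aut_orbit_eq_iff:
  assumes "x \<in> carrier G" "y \<in> carrier G"
  shows "aut_orbit G x = aut_orbit G y \<longleftrightarrow> aut_equiv G x y"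
  using assms aut_equiv_refl aut_equiv_sym aut_equiv_trans unfolding aut_orbit_def by blast

text \<open>Two maps with the same fibres on \<open>S\<close> have equinumerous images, via f x to g
  x. This compares orbits with values of an invariant, also when there are infinitely many.\<close>

lemma card_of_image_ordIso:
  assumes "\<And>x y. x \<in> S \<Longrightarrow> y \<in> S \<Longrightarrow> f x = f y \<longleftrightarrow> g x = g y"
  shows "|f ` S| =o |g ` S|"
proof -
  have "bij_betw (\<lambda>u. g (inv_into S f u)) (f ` S) (g ` S)"
    unfolding bij_betw_def
  proof
    show "inj_on (\<lambda>u. g (inv_into S f u)) (f ` S)"
      by (rule inj_onI) (metis assms f_inv_into_f inv_into_into)
    have "g (inv_into S f (f x)) = g x" if "x \<in> S" for x
      using assms[of "inv_into S f (f x)" x] that by (simp add: f_inv_into_f inv_into_into)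
    then show "(\<lambda>u. g (inv_into S f u)) ` (f ` S) = g ` S"
      by (simp add: image_image cong: image_cong)
  qed
  then show ?thesis
    using card_of_ordIso by blast
qed

section \<open>Explicit automorphisms of the semidirect product\<close>

lemma SL2_semidirect_matrices_simps [simp]:
  "x \<in> carrier SL2_semidirect_matrices \<longleftrightarrow> det (fst x) = 1"
  "(A, M) \<otimes>\<^bsub>SL2_semidirect_matrices\<^esub> (B, N) = (A ** B, M + A ** N)"
  "\<one>\<^bsub>SL2_semidirect_matrices\<^esub> = (mat 1, 0)"
  by (cases x; simp add: SL2_semidirect_matrices_def semidirect_product_def additive_group_def)+

lemma fst_mult_SL2_semidirect_matrices [simp]:
  "fst (x \<otimes>\<^bsub>SL2_semidirect_matrices\<^esub> y) = fst x ** fst y"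
  by (cases x; cases y) simp

lemma matrix_add_rdistrib: "(A + B) ** X = A ** X + B ** X"
  by (simp add: vec_eq_iff matrix_matrix_mult_def sum.distrib distrib_right)

text \<open>Left multiplication by \<open>g\<close> is compatible with conjugating the acting matrix
  by \<open>g\<close>, and right multiplication by \<open>h\<close> commutes with the action. Both
  may have arbitrary nonzero determinant.\<close>

lemma aut_equiv_linear:
  fixes A g g' :: "'a::field ^ 2 ^ 2" and M :: "'a ^ 'm::finite ^ 2" and h h' :: "'a ^ 'm ^ 'm"
  assumes "g ** g' = mat 1" "g' ** g = mat 1" "h ** h' = mat 1" "h' ** h = mat 1" "det A = 1"
  shows "aut_equiv SL2_semidirect_matrices (A, M) (g ** A ** g', g ** M ** h)"
proof -
  let ?f = "\<lambda>(A, M). (g ** A ** g', g ** M ** h)"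
  have cancel: "g ** (g' ** X) = X" "g' ** (g ** X) = X" for X :: "'a ^ 'n::finite ^ 2"
    by (simp_all add: matrix_mul_assoc assms)
  have det_g: "det g * det g' = 1"
    by (metis det_I det_mul assms(1))
  have det_conj: "det (g ** A ** g') = det A" "det (g' ** A ** g) = det A" for A
    using det_g by (simp_all add: det_mul mult.commute mult.left_commute)
  have "?f \<in> hom SL2_semidirect_matrices SL2_semidirect_matrices"
    by (auto simp: hom_def det_conj)
      (simp_all add: cancel matrix_add_ldistrib matrix_add_rdistrib flip: matrix_mul_assoc)
  moreover have "bij_betw ?f (carrier SL2_semidirect_matrices) (carrier SL2_semidirect_matrices)"
    by (rule bij_betw_byWitness[where f' = "\<lambda>(A, M). (g' ** A ** g, g' ** M ** h')"])
      (auto simp: det_conj, auto simp: assms cancel simp flip: matrix_mul_assoc)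
  ultimately show ?thesis
    using group.aut_equivI[OF group_SL2_semidirect_matrices, of ?f "(A, M)"] assms(5) by simp
qed

text \<open>Entrywise application of \<open>\<sigma>\<close> respects sums, products and
  determinants.\<close>

lemma aut_equiv_field:
  fixes A :: "'a::field ^ 2 ^ 2" and M :: "'a ^ 'm::finite ^ 2"
  assumes \<sigma>: "field_aut \<sigma>" and "det A = 1"
  shows "aut_equiv SL2_semidirect_matrices (A, M) (map_matrix \<sigma> A, map_matrix \<sigma> M)"
proof -
  let ?f = "\<lambda>(A, M). (map_matrix \<sigma> A, map_matrix \<sigma> M)"
  have diff: "\<sigma> (x - y) = \<sigma> x - \<sigma> y" for x y
    using field_autD(2)[OF \<sigma>, of "x - y" y] by simp
  have det: "det (map_matrix \<sigma> B) = \<sigma> (det B)" for B :: "'a ^ 2 ^ 2"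
    by (simp add: det_2 diff field_autD(3)[OF \<sigma>])
  define \<tau> where "\<tau> = inv_into UNIV \<sigma>"
  have inv: "\<sigma> (\<tau> x) = x" "\<tau> (\<sigma> x) = x" for x
    using field_autD(1)[OF \<sigma>] by (simp_all add: \<tau>_def bij_is_surj surj_f_inv_f bij_is_inj)
  have "?f \<in> hom SL2_semidirect_matrices SL2_semidirect_matrices"
    by (auto simp: hom_def det field_autD[OF \<sigma>] map_matrix_mult[OF \<sigma>] map_matrix_add[OF \<sigma>])
  moreover have "bij_betw ?f (carrier SL2_semidirect_matrices) (carrier SL2_semidirect_matrices)"
  proof (rule bij_betw_byWitness[where f' = "\<lambda>(A, M). (map_matrix \<tau> A, map_matrix \<tau> M)"])
    \<comment> \<open>That the inverse \<open>\<tau>\<close> also preserves determinant 1 follows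
      from the determinant rule for \<open>\<sigma>\<close> and injectivity.\<close>
    have "det (map_matrix \<tau> B) = 1" if "det B = 1" for B :: "'a ^ 2 ^ 2"
    proof -
      have "map_matrix \<sigma> (map_matrix \<tau> B) = B"
        by (simp add: vec_eq_iff inv)
      then have "\<sigma> (det (map_matrix \<tau> B)) = \<sigma> 1"
        using det[of "map_matrix \<tau> B"] that field_autD(5)[OF \<sigma>] by simp
      then show ?thesis
        by (metis inv(2))
    qed
    then show "(\<lambda>(A, M). (map_matrix \<tau> A, map_matrix \<tau> M)) `
        carrier SL2_semidirect_matrices \<subseteq> carrier SL2_semidirect_matrices"
      by auto
  qed (auto simp: vec_eq_iff inv det field_autD[OF \<sigma>])
  ultimately show ?thesis
    using group.aut_equivI[OF group_SL2_semidirect_matrices, of ?f "(A, M)"] assms(2) by simp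
qed

lemma matrix_diff_ldistrib: "A ** (X - Y) = A ** X - A ** Y"
  for A :: "'a::ring_1 ^ 'n ^ 'm"
  by (simp add: vec_eq_iff matrix_matrix_mult_def sum_subtractf right_diff_distrib)

text \<open>This is conjugation by the element (1, X).\<close>

lemma aut_equiv_shift:
  fixes A :: "'a::field ^ 2 ^ 2" and M X :: "'a ^ 'm::finite ^ 2"
  assumes "det A = 1"
  shows "aut_equiv SL2_semidirect_matrices (A, M) (A, M + X - A ** X)"
proof -
  let ?f = "\<lambda>(A, M). (A, M + X - A ** X)"
  have "?f \<in> hom SL2_semidirect_matrices SL2_semidirect_matrices"
    by (auto simp: hom_def det_mul matrix_add_ldistrib matrix_diff_ldistrib algebra_simps
        matrix_mul_assoc)
  moreover have "bij_betw ?f (carrier SL2_semidirect_matrices) (carrier SL2_semidirect_matrices)"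
    by (rule bij_betw_byWitness[where f' = "\<lambda>(A, M). (A, M - X + A ** X)"]) auto
  ultimately show ?thesis
    using group.aut_equivI[OF group_SL2_semidirect_matrices, of ?f "(A, M)"] assms by simp
qed

text \<open>An injection between independent sets extends to an injective linear map, hence to an
  invertible matrix. It is transposed because rows are multiplied from the right.\<close>

lemma GL_extends_independent:
  fixes f :: "'a::field ^ 'm::finite \<Rightarrow> 'a ^ 'm"
  assumes "vec.independent S" "inj_on f S" "vec.independent (f ` S)"
  obtains h h' where "h ** h' = mat 1" "h' ** h = mat 1" "\<And>v. v \<in> S \<Longrightarrow> v v* h = f v"
proof -
  obtain T where T: "Vector_Spaces.linear (*s) (*s) T" "inj T" "\<forall>v\<in>S. T v = f v"
    using vec.linear_independent_extend_inj[OF assms(1,3,2)] by blast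
  have "(*v) (matrix T) = T"
    using matrix_works[OF T(1)] by (simp add: fun_eq_iff)
  then obtain B where B: "B ** matrix T = mat 1"
    using T(2) matrix_left_invertible_injective[of "matrix T"] by auto
  show thesis
  proof (rule that)
    show "transpose (matrix T) ** transpose B = mat 1"
      by (metis B matrix_transpose_mul transpose_mat)
    then show "transpose B ** transpose (matrix T) = mat 1"
      by (simp add: matrix_left_right_inverse)
    show "v v* transpose (matrix T) = f v" if "v \<in> S" for v
      using T(3) that by (simp add: matrix_works[OF T(1)])
  qed
qed

lemma nth_matrix_mult: "(M ** h) $ i = M $ i v* h"
  by (simp add: vec_eq_iff matrix_matrix_mult_def vector_matrix_mult_def)

lemma mat2_mult_nth:
  "(mat2 a b c d ** M) $ 1 = a *s M $ 1 + b *s M $ 2"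
  "(mat2 a b c d ** M) $ 2 = c *s M $ 1 + d *s M $ 2"
  by (simp_all add: vec_eq_iff matrix_matrix_mult_def sum_2)

lemma rows2_eq_iff: "M = N \<longleftrightarrow> M $ 1 = N $ 1 \<and> M $ 2 = N $ 2" for M N :: "'a ^ 'm::finite ^ 2"
  by (simp add: vec_eq_iff[of M N] forall_2)

text \<open>The row is chosen so that \<open>mat2 1 1 0 1\<close> moves the matrix whenever
  \<open>w\<close> is nonzero, whereas \<open>mat2 1 0 1 1\<close> fixes it.\<close>

definition second_row :: "'a::zero ^ 'm::finite \<Rightarrow> 'a ^ 'm ^ 2" where
  "second_row w = vector [0, w]"

lemma second_row_nth [simp]: "second_row w $ 1 = 0" "second_row w $ 2 = w"
  by (simp_all add: second_row_def)

section \<open>Normal forms\<close>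

lemma semidirect_aut_equiv_sym:
  assumes "aut_equiv SL2_semidirect_matrices x y" "det (fst x) = 1"
  shows "aut_equiv SL2_semidirect_matrices y x"
  using group.aut_equiv_sym[OF group_SL2_semidirect_matrices assms(1)] assms(2) by simp

lemma semidirect_aut_equiv_trans:
  assumes "aut_equiv SL2_semidirect_matrices x y" "aut_equiv SL2_semidirect_matrices y z"
    "det (fst x) = 1"
  shows "aut_equiv SL2_semidirect_matrices x z"
  using group.aut_equiv_trans[OF group_SL2_semidirect_matrices assms(1,2)] assms(3) by simp

lemma vec_independent_pair_iff:
  fixes r s :: "'a::field ^ 'm::finite"
  assumes "r \<noteq> s"
  shows "vec.independent {r, s} \<longleftrightarrow> s \<noteq> 0 \<and> (\<forall>k. r \<noteq> k *s s)"
  using assms by (auto simp: vec.independent_insert vec.span_singleton vec.dependent_single)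

text \<open>If the rows are dependent, all columns of \<open>M\<close> lie on one line, and a
  nontrivial transvection with this axis fixes \<open>M\<close>.\<close>

lemma fixed_only_by_one_rows:
  fixes M :: "'a::field ^ 'm::finite ^ 2"
  assumes char: "CHAR('a) = 2"
    and free: "\<forall>A. det A = 1 \<longrightarrow> A ** M = M \<longrightarrow> A = mat 1"
  shows "M $ 1 \<noteq> M $ 2" "vec.independent {M $ 1, M $ 2}"
proof -
  note c2 = char2_simps[OF char]
  have s: "M $ 2 \<noteq> 0"
  proof
    assume "M $ 2 = 0"
    then have "mat2 1 1 0 1 ** M = M"
      by (simp add: rows2_eq_iff mat2_mult_nth)
    then show False
      using free[rule_format, of "mat2 1 1 0 1"] by (simp add: mat_1_eq_mat2)
  qed
  have r: "M $ 1 \<noteq> k *s M $ 2" for k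
  proof
    assume k: "M $ 1 = k *s M $ 2"
    \<comment> \<open>The columns of \<open>M\<close> are multiples of (k, 1). This matrix is 1 plus
      the product of the column (k, 1) and the row (1, k), and that row kills (k, 1) in
      characteristic 2.\<close>
    have "mat2 (1 + k) (k * k) 1 (1 + k) ** M = M"
      by (simp add: rows2_eq_iff mat2_mult_nth k vec_eq_iff algebra_simps c2)
    moreover have "det (mat2 (1 + k) (k * k) 1 (1 + k)) = 1"
      by (simp add: algebra_simps c2)
    ultimately show False
      using free[rule_format, of "mat2 (1 + k) (k * k) 1 (1 + k)"] by (simp add: mat_1_eq_mat2)
  qed
  show "M $ 1 \<noteq> M $ 2"
    using r[of 1] by simp
  then show "vec.independent {M $ 1, M $ 2}"
    using r s by (simp add: vec_independent_pair_iff)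
qed

text \<open>A trivial stabilizer makes the rows independent, and right multiplication by invertible
  matrices is transitive on independent pairs of rows.\<close>

lemma aut_equiv_of_rank_two:
  fixes M N :: "'a::field ^ 'm::finite ^ 2"
  assumes char: "CHAR('a) = 2"
    and "\<forall>A. det A = 1 \<longrightarrow> A ** M = M \<longrightarrow> A = mat 1"
    and "\<forall>A. det A = 1 \<longrightarrow> A ** N = N \<longrightarrow> A = mat 1"
  shows "aut_equiv SL2_semidirect_matrices (mat 1 :: 'a ^ 2 ^ 2, M) (mat 1, N)"
proof -
  note M = fixed_only_by_one_rows[OF char assms(2)]
  note N = fixed_only_by_one_rows[OF char assms(3)]
  define f where "f v = (if v = M $ 1 then N $ 1 else N $ 2)" for v
  have f: "f (M $ 1) = N $ 1" "f (M $ 2) = N $ 2"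
    using M(1) by (simp_all add: f_def)
  then have "inj_on f {M $ 1, M $ 2}" "vec.independent (f ` {M $ 1, M $ 2})"
    using N by auto
  from GL_extends_independent[OF M(2) this]
  obtain h h' where h: "h ** h' = mat 1" "h' ** h = mat 1"
    "\<And>v. v \<in> {M $ 1, M $ 2} \<Longrightarrow> v v* h = f v"
    by metis
  then have "M ** h = N"
    by (simp add: rows2_eq_iff nth_matrix_mult f)
  then show ?thesis
    using aut_equiv_linear[of "mat 1" "mat 1" h h' "mat 1 :: 'a ^ 2 ^ 2" M] h by simp
qed

text \<open>Right multiplication leaves \<open>A\<close> alone and is transitive on nonzero rows.
  This serves both the rank one and the order four orbit.\<close>

lemma aut_equiv_second_row:
  fixes v w :: "'a::field ^ 'm::finite"
  assumes "v \<noteq> 0" "w \<noteq> 0" "det A = 1"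
  shows "aut_equiv SL2_semidirect_matrices (A :: 'a ^ 2 ^ 2, second_row v) (A, second_row w)"
proof -
  have "vec.independent {v}" "inj_on (\<lambda>_. w) {v}" "vec.independent ((\<lambda>_. w) ` {v})"
    using assms by simp_all
  then obtain h h' where h: "h ** h' = mat 1" "h' ** h = mat 1" "v v* h = w"
    by (rule GL_extends_independent[where f = "\<lambda>_. w"]) auto
  then have "second_row v ** h = second_row w"
    by (simp add: rows2_eq_iff nth_matrix_mult)
  then show ?thesis
    using aut_equiv_linear[of "mat 1" "mat 1" h h' A "second_row v"] h assms by simp
qed

text \<open>A nonzero row of A - 1 is a linear relation (x, y) between the rows of \<open>M\<close>.
  Completed to an invertible matrix \<open>g\<close>, it clears the first row.\<close>

lemma rank_one_normal_form:
  fixes M :: "'a::field ^ 'm::finite ^ 2"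
  assumes "M \<noteq> 0" "A ** M = M" "A \<noteq> mat 1"
  obtains w where "w \<noteq> 0"
    "aut_equiv SL2_semidirect_matrices (mat 1 :: 'a ^ 2 ^ 2, M) (mat 1, second_row w)"
proof -
  obtain a b c d where A: "A = mat2 a b c d" by (rule mat2_cases)
  have "(a - 1) *s M $ 1 + b *s M $ 2 = 0" "c *s M $ 1 + (d - 1) *s M $ 2 = 0"
    using assms(2) by (simp_all add: A rows2_eq_iff mat2_mult_nth vec_eq_iff algebra_simps)
  moreover have "a - 1 \<noteq> 0 \<or> b \<noteq> 0 \<or> c \<noteq> 0 \<or> d - 1 \<noteq> 0"
    using assms(3) by (auto simp: A mat_1_eq_mat2)
  ultimately obtain x y where xy: "x \<noteq> 0 \<or> y \<noteq> 0" "x *s M $ 1 + y *s M $ 2 = 0"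
    by blast
  define g where "g = (if x = 0 then mat2 0 y 1 0 else mat2 x y 0 1)"
  have "det g \<noteq> 0"
    using xy(1) by (auto simp: g_def)
  then obtain g' where g': "g ** g' = mat 1" "g' ** g = mat 1"
    by (auto simp: invertible_def simp flip: invertible_det_nz)
  have "(g ** M) $ 1 = 0"
    using xy(2) by (auto simp: g_def mat2_mult_nth)
  then have gM: "g ** M = second_row ((g ** M) $ 2)"
    by (simp add: rows2_eq_iff)
  have "(g ** M) $ 2 \<noteq> 0"
  proof
    assume "(g ** M) $ 2 = 0"
    then have "g ** M = 0"
      using gM by (simp add: rows2_eq_iff)
    then have "g' ** (g ** M) = 0"
      by simp
    with assms(1) show False
      by (simp add: matrix_mul_assoc g')
  qed
  moreover have "aut_equiv SL2_semidirect_matrices (mat 1, M) (mat 1, g ** M)"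
    using aut_equiv_linear[of g g' "mat 1" "mat 1" "mat 1" M] g' by simp
  ultimately show thesis
    using that gM by metis
qed

lemma aut_equiv_of_rank_one:
  fixes M N :: "'a::field ^ 'm::finite ^ 2"
  assumes "M \<noteq> 0" "A ** M = M" "A \<noteq> mat 1" and "N \<noteq> 0" "B ** N = N" "B \<noteq> mat 1"
  shows "aut_equiv SL2_semidirect_matrices (mat 1 :: 'a ^ 2 ^ 2, M) (mat 1, N)"
proof -
  obtain v w where v: "v \<noteq> 0"
      "aut_equiv SL2_semidirect_matrices (mat 1 :: 'a ^ 2 ^ 2, M) (mat 1, second_row v)"
    and w: "w \<noteq> 0"
      "aut_equiv SL2_semidirect_matrices (mat 1 :: 'a ^ 2 ^ 2, N) (mat 1, second_row w)"
    using rank_one_normal_form[OF assms(1-3)] rank_one_normal_form[OF assms(4-6)] by metis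
  note semidirect_aut_equiv_trans[OF v(2) aut_equiv_second_row[OF v(1) w(1)]]
  note semidirect_aut_equiv_trans[OF this semidirect_aut_equiv_sym[OF w(2)]]
  then show ?thesis
    by simp
qed

text \<open>First a change of basis turns \<open>A\<close> into the standard transvection; then a
  shift clears the first row of the matrix part.\<close>

lemma involution_normal_form:
  fixes A :: "'a::field ^ 2 ^ 2" and M :: "'a ^ 'm::finite ^ 2"
  assumes char: "CHAR('a) = 2" and A: "det A = 1" "A ** A = mat 1" "A \<noteq> mat 1"
  obtains w where "aut_equiv SL2_semidirect_matrices (A, M) (mat2 1 1 0 1, second_row w)"
proof -
  note c2 = char2_simps[OF char]
  obtain p b c where Aeq: "A = mat2 (p + 1) b c (p + 1)" and p: "p * p = b * c"
    using SL2_involution_form[OF char A(1,2)] by blast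
  \<comment> \<open>The second column is a standard unit vector not fixed by \<open>A\<close>, the
    first column its image under A - 1.\<close>
  define h where "h = (if b = 0 then mat2 0 1 c 0 else mat2 b 0 p 1)"
  have bc: "b \<noteq> 0 \<or> c \<noteq> 0"
    using A(3) p by (auto simp: Aeq mat_1_eq_mat2)
  then have "det h \<noteq> 0"
    by (auto simp: h_def)
  then obtain h' where h': "h ** h' = mat 1" "h' ** h = mat 1"
    by (auto simp: invertible_def simp flip: invertible_det_nz)
  have "p = 0" if "b = 0"
    using p that by simp
  then have "A ** h = h ** mat2 1 1 0 1"
    by (auto simp: Aeq h_def algebra_simps c2 p)
  then have "h' ** A ** h = mat2 1 1 0 1"
    by (simp flip: matrix_mul_assoc) (simp add: h' matrix_mul_assoc)
  then have 1: "aut_equiv SL2_semidirect_matrices (A, M) (mat2 1 1 0 1, h' ** M)"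
    using aut_equiv_linear[of h' h "mat 1" "mat 1" A M] h' A(1) by simp
  define X :: "'a ^ 'm ^ 2" where "X = second_row ((h' ** M) $ 1)"
  have "h' ** M + X - mat2 1 1 0 1 ** X = second_row ((h' ** M) $ 2)"
    by (simp add: rows2_eq_iff mat2_mult_nth X_def)
  then have 2: "aut_equiv SL2_semidirect_matrices (mat2 1 1 0 1, h' ** M)
      (mat2 1 1 0 1, second_row ((h' ** M) $ 2))"
    using aut_equiv_shift[of "mat2 1 1 0 1" "h' ** M" X] by simp
  show thesis
    by (rule that, rule semidirect_aut_equiv_trans[OF 1 2]) (simp add: A)
qed

text \<open>In characteristic 2 with determinant 1, det (A + 1) equals the trace, and trace 0 would
  give A^2 = 1 by Cayley-Hamilton. So A + 1 is invertible and a suitable shift removes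
  \<open>M\<close>.\<close>

lemma aut_equiv_not_involution:
  fixes A :: "'a::field ^ 2 ^ 2" and M :: "'a ^ 'm::finite ^ 2"
  assumes char: "CHAR('a) = 2" and A: "det A = 1" "A ** A \<noteq> mat 1"
  shows "aut_equiv SL2_semidirect_matrices (A, M) (A, 0)"
proof -
  note c2 = char2_simps[OF char]
  obtain a b c d where Aeq: "A = mat2 a b c d" by (rule mat2_cases)
  have det: "a * d + b * c = 1"
    using A(1) by (simp add: Aeq c2)
  have "a \<noteq> d"
  proof
    assume "a = d"
    then have "A ** A = mat 1"
      using det by (simp add: Aeq mat_1_eq_mat2 mult.commute add.commute c2)
    with A(2) show False ..
  qed
  have "A + mat 1 = mat2 (a + 1) b c (d + 1)"
    by (simp add: Aeq mat_1_eq_mat2)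
  then have "det (A + mat 1) = (a * d + b * c) + 1 + (a + d)"
    by (simp add: algebra_simps c2)
  also have "\<dots> \<noteq> 0"
    using \<open>a \<noteq> d\<close> by (simp add: det c2)
  finally obtain B where B: "(A + mat 1) ** B = mat 1"
    by (auto simp: invertible_def simp flip: invertible_det_nz)
  define X where "X = B ** M"
  have "(A + mat 1) ** X = M"
    by (simp add: X_def matrix_mul_assoc B)
  then have "M = A ** X + X"
    by (simp add: matrix_add_rdistrib)
  then have "M + X - A ** X = 0"
    by (simp add: vec_eq_iff c2)
  then show ?thesis
    using aut_equiv_shift[OF A(1), of M X] by simp
qed

text \<open>The automorphism of SL(2) is a field automorphism followed by conjugation. Both extend
  to the semidirect product and keep the zero matrix.\<close>

lemma aut_equiv_SL2_lift:
  fixes A B :: "'a::field ^ 2 ^ 2"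
  assumes char: "CHAR('a) = 2" and "aut_equiv SL2 A B" "det A = 1"
  shows "aut_equiv SL2_semidirect_matrices (A, 0 :: 'a ^ 'm::finite ^ 2) (B, 0)"
proof -
  obtain \<beta> where \<beta>: "\<beta> \<in> auto SL2" "\<beta> A = B"
    using assms by (auto simp: aut_equiv_def)
  obtain h h' \<sigma> where h: "h ** h' = mat 1" "h' ** h = mat 1" and \<sigma>: "field_aut \<sigma>"
    and eq: "\<And>A. det A = 1 \<Longrightarrow> \<beta> A = h ** map_matrix \<sigma> A ** h'"
    using automorphism_SL2_semilinear[OF char \<beta>(1)] by metis
  note 1 = aut_equiv_field[OF \<sigma> assms(3), of "0 :: 'a ^ 'm ^ 2"]
  from aut_equiv_closed[OF 1] assms(3) have "det (map_matrix \<sigma> A) = 1"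
    by simp
  from aut_equiv_linear[OF h, of "mat 1" "mat 1", OF _ _ this, of 0]
  have "aut_equiv SL2_semidirect_matrices (map_matrix \<sigma> A, 0 :: 'a ^ 'm ^ 2) (B, 0)"
    using eq[OF assms(3)] \<beta>(2) by simp
  moreover have "map_matrix \<sigma> (0 :: 'a ^ 'm ^ 2) = 0"
    by (simp add: vec_eq_iff field_autD[OF \<sigma>])
  ultimately show ?thesis
    using semidirect_aut_equiv_trans[OF 1] assms(3) by simp
qed

section \<open>The characteristic subgroup of matrices\<close>

text \<open>Testing with elementary matrices of entry \<open>t\<close> yields equations that, for a
  nonzero off-diagonal entry, have at most two roots \<open>t\<close>; a third field element
  excludes this. Over the field with two elements, the elements of order 3 would be
  counterexamples.\<close>

lemma commutes_with_involutive_conjugates: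
  fixes A :: "'a::field ^ 2 ^ 2"
  assumes char: "CHAR('a) = 2" and large: "infinite (UNIV :: 'a set) \<or> CARD('a) > 2"
    and det: "det A = 1"
    and comm: "\<And>B. det B = 1 \<Longrightarrow> B ** B = mat 1 \<Longrightarrow> A ** (B ** A ** B) = (B ** A ** B) ** A"
  shows "A = mat 1"
proof -
  note c2 = char2_simps[OF char]
  obtain a b c d where A: "A = mat2 a b c d" by (rule mat2_cases)
  have upper: "c * (t * (a + d) + t * t * c) = 0" for t
    using comm[of "mat2 1 t 0 1"] by (simp add: A mat_1_eq_mat2 c2 algebra_simps)
  have lower: "b * (t * (a + d) + t * t * b) = 0" for t
    using comm[of "mat2 1 0 t 1"] by (simp_all add: A mat_1_eq_mat2 c2 algebra_simps)
  have zero: "e = 0" if "\<And>t. e * (t * (a + d) + t * t * e) = 0" for e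
  proof (rule ccontr)
    assume e: "e \<noteq> 0"
    \<comment> \<open>Here the size of the field enters: some \<open>t\<close> avoids both
      roots.\<close>
    have "\<not> UNIV \<subseteq> {0, (a + d) / e}"
    proof
      assume sub: "UNIV \<subseteq> {0, (a + d) / e}"
      then have fin: "finite (UNIV :: 'a set)"
        by (rule finite_subset) simp
      have "CARD('a) \<le> card {0, (a + d) / e}"
        using sub by (intro card_mono) auto
      also have "\<dots> \<le> 2"
        by (simp add: card_insert_if)
      finally show False
        using large fin by simp
    qed
    then obtain t where t: "t \<noteq> 0" "t \<noteq> (a + d) / e"
      by auto
    have "e * (t * (a + d) + t * t * e) = e * t * ((a + d) + t * e)"
      by (simp add: algebra_simps)
    then have "(a + d) + t * e = 0"
      using that[of t] t(1) e by simp
    then show False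
      using t(2) e by (simp add: c2 eq_divide_eq)
  qed
  have "c = 0" "b = 0"
    using upper lower by (blast intro: zero)+
  moreover from this have "a * a = d * d"
    using comm[of "mat2 1 1 0 1"] by (simp add: A mat_1_eq_mat2 c2 algebra_simps)
  then have "(a + d) * (a + d) = 0"
    by (simp add: algebra_simps c2)
  then have "a = d"
    by (simp add: c2)
  moreover from this \<open>c = 0\<close> have "d * d = 1"
    using det by (simp add: A)
  then have "(d + 1) * (d + 1) = 0"
    by (simp add: algebra_simps c2)
  then have "d = 1"
    by (simp add: c2)
  ultimately show ?thesis
    by (simp add: A mat_1_eq_mat2)
qed

text \<open>This makes the normal subgroup of matrices characteristic.\<close>

lemma fst_eq_one_iff:
  fixes x :: "('a::field ^ 2 ^ 2) \<times> ('a ^ 'm::finite ^ 2)"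
  assumes char: "CHAR('a) = 2" and large: "infinite (UNIV :: 'a set) \<or> CARD('a) > 2"
    and x: "det (fst x) = 1"
  defines "G \<equiv> SL2_semidirect_matrices :: (('a ^ 2 ^ 2) \<times> ('a ^ 'm ^ 2)) monoid"
  shows "fst x = mat 1 \<longleftrightarrow> (\<forall>y\<in>carrier G. y \<otimes>\<^bsub>G\<^esub> y = \<one>\<^bsub>G\<^esub> \<longrightarrow>
    x \<otimes>\<^bsub>G\<^esub> (y \<otimes>\<^bsub>G\<^esub> x \<otimes>\<^bsub>G\<^esub> y) = (y \<otimes>\<^bsub>G\<^esub> x \<otimes>\<^bsub>G\<^esub> y) \<otimes>\<^bsub>G\<^esub> x)"
proof
  assume one: "fst x = mat 1"
  show "\<forall>y\<in>carrier G. y \<otimes>\<^bsub>G\<^esub> y = \<one>\<^bsub>G\<^esub> \<longrightarrow>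
    x \<otimes>\<^bsub>G\<^esub> (y \<otimes>\<^bsub>G\<^esub> x \<otimes>\<^bsub>G\<^esub> y) = (y \<otimes>\<^bsub>G\<^esub> x \<otimes>\<^bsub>G\<^esub> y) \<otimes>\<^bsub>G\<^esub> x"
  \<comment> \<open>As \<open>y\<close> is its own inverse, \<open>y x y\<close> is a conjugate of
    \<open>x\<close>; both lie in the abelian subgroup of matrices.\<close>
  proof (intro ballI impI)
    fix y assume "y \<otimes>\<^bsub>G\<^esub> y = \<one>\<^bsub>G\<^esub>"
    then have "fst (y \<otimes>\<^bsub>G\<^esub> x \<otimes>\<^bsub>G\<^esub> y) = mat 1"
      by (cases y) (simp add: G_def one)
    then obtain M N where "x = (mat 1, M)" "y \<otimes>\<^bsub>G\<^esub> x \<otimes>\<^bsub>G\<^esub> y = (mat 1, N)"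
      using one by (metis prod.collapse)
    then show "x \<otimes>\<^bsub>G\<^esub> (y \<otimes>\<^bsub>G\<^esub> x \<otimes>\<^bsub>G\<^esub> y) = (y \<otimes>\<^bsub>G\<^esub> x \<otimes>\<^bsub>G\<^esub> y) \<otimes>\<^bsub>G\<^esub> x"
      by (simp add: G_def add.commute)
  qed
next
  assume R: "\<forall>y\<in>carrier G. y \<otimes>\<^bsub>G\<^esub> y = \<one>\<^bsub>G\<^esub> \<longrightarrow>
    x \<otimes>\<^bsub>G\<^esub> (y \<otimes>\<^bsub>G\<^esub> x \<otimes>\<^bsub>G\<^esub> y) = (y \<otimes>\<^bsub>G\<^esub> x \<otimes>\<^bsub>G\<^esub> y) \<otimes>\<^bsub>G\<^esub> x"
  show "fst x = mat 1"
  proof (rule commutes_with_involutive_conjugates[OF char large x])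
    fix B :: "'a ^ 2 ^ 2" assume B: "det B = 1" "B ** B = mat 1"
    let ?y = "(B, 0) :: ('a ^ 2 ^ 2) \<times> ('a ^ 'm ^ 2)"
    have "x \<otimes>\<^bsub>G\<^esub> (?y \<otimes>\<^bsub>G\<^esub> x \<otimes>\<^bsub>G\<^esub> ?y) = (?y \<otimes>\<^bsub>G\<^esub> x \<otimes>\<^bsub>G\<^esub> ?y) \<otimes>\<^bsub>G\<^esub> x"
      using R B by (simp add: G_def)
    from arg_cong[OF this, of fst]
    show "fst x ** (B ** fst x ** B) = (B ** fst x ** B) ** fst x"
      by (simp add: G_def)
  qed
qed

section \<open>The automorphism induced on the quotient SL(2)\<close>

locale SL2_extension_automorphism =
  fixes G :: "(('a::field ^ 2 ^ 2) \<times> ('a ^ 'm::finite ^ 2)) monoid"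
    and \<alpha> :: "('a ^ 2 ^ 2) \<times> ('a ^ 'm ^ 2) \<Rightarrow> ('a ^ 2 ^ 2) \<times> ('a ^ 'm ^ 2)"
  assumes G_def: "G = SL2_semidirect_matrices"
    and char: "CHAR('a) = 2" and large: "infinite (UNIV :: 'a set) \<or> CARD('a) > 2"
    and auto: "\<alpha> \<in> auto G"
begin

lemma group_G: "group G"
  by (simp add: G_def group_SL2_semidirect_matrices)

lemma carrier_iff: "x \<in> carrier G \<longleftrightarrow> det (fst x) = 1"
  by (simp add: G_def)

lemma \<alpha>_mult: "x \<in> carrier G \<Longrightarrow> y \<in> carrier G \<Longrightarrow> \<alpha> (x \<otimes>\<^bsub>G\<^esub> y) = \<alpha> x \<otimes>\<^bsub>G\<^esub> \<alpha> y"
  using autoD(1)[OF auto] by (rule hom_mult)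

lemma \<alpha>_closed: "x \<in> carrier G \<Longrightarrow> \<alpha> x \<in> carrier G"
  using autoD(1)[OF auto] by (rule hom_in_carrier)

lemma \<alpha>_eq_iff: "x \<in> carrier G \<Longrightarrow> y \<in> carrier G \<Longrightarrow> \<alpha> x = \<alpha> y \<longleftrightarrow> x = y"
  using autoD(2)[OF auto] by (auto simp: bij_betw_def inj_on_def)

lemma \<alpha>_image: "carrier G = \<alpha> ` carrier G"
  using autoD(2)[OF auto] by (simp add: bij_betw_def)

lemma \<alpha>_one: "\<alpha> \<one>\<^bsub>G\<^esub> = \<one>\<^bsub>G\<^esub>"
  using hom_one[OF autoD(1)[OF auto] group_G group_G] .

lemma mult_closed: "x \<in> carrier G \<Longrightarrow> y \<in> carrier G \<Longrightarrow> x \<otimes>\<^bsub>G\<^esub> y \<in> carrier G"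
  using group_G by (rule group.is_monoid[THEN monoid.m_closed])

lemma one_closed: "\<one>\<^bsub>G\<^esub> \<in> carrier G"
  by (simp add: G_def)

lemma \<alpha>_eq_one_iff: "x \<in> carrier G \<Longrightarrow> \<alpha> x = \<one>\<^bsub>G\<^esub> \<longleftrightarrow> x = \<one>\<^bsub>G\<^esub>"
  using \<alpha>_eq_iff[of x "\<one>\<^bsub>G\<^esub>"] by (simp add: \<alpha>_one one_closed)

text \<open>The criterion \<open>fst_eq_one_iff\<close> uses only the group operation, so it is
  transported by \<open>\<alpha>\<close> after the carrier is rewritten as its own image.\<close>

lemma fst_\<alpha>_eq_one_iff:
  assumes "x \<in> carrier G"
  shows "fst (\<alpha> x) = mat 1 \<longleftrightarrow> fst x = mat 1"
proof -
  have "fst (\<alpha> x) = mat 1 \<longleftrightarrow> (\<forall>y\<in>\<alpha> ` carrier G. y \<otimes>\<^bsub>G\<^esub> y = \<one>\<^bsub>G\<^esub> \<longrightarrow>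
    \<alpha> x \<otimes>\<^bsub>G\<^esub> (y \<otimes>\<^bsub>G\<^esub> \<alpha> x \<otimes>\<^bsub>G\<^esub> y) = (y \<otimes>\<^bsub>G\<^esub> \<alpha> x \<otimes>\<^bsub>G\<^esub> y) \<otimes>\<^bsub>G\<^esub> \<alpha> x)"
    using fst_eq_one_iff[OF char large, of "\<alpha> x"] \<alpha>_closed[OF assms]
    unfolding \<alpha>_image[symmetric] by (simp add: G_def)
  also have "\<dots> \<longleftrightarrow> (\<forall>y\<in>carrier G. y \<otimes>\<^bsub>G\<^esub> y = \<one>\<^bsub>G\<^esub> \<longrightarrow>
    x \<otimes>\<^bsub>G\<^esub> (y \<otimes>\<^bsub>G\<^esub> x \<otimes>\<^bsub>G\<^esub> y) = (y \<otimes>\<^bsub>G\<^esub> x \<otimes>\<^bsub>G\<^esub> y) \<otimes>\<^bsub>G\<^esub> x)"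
    using assms by (simp add: \<alpha>_eq_iff \<alpha>_eq_one_iff mult_closed flip: \<alpha>_mult)
  also have "\<dots> \<longleftrightarrow> fst x = mat 1"
    using fst_eq_one_iff[OF char large, of x] assms by (simp add: G_def)
  finally show ?thesis .
qed

lemma fst_\<alpha>_eq:
  assumes "det A = 1"
  shows "fst (\<alpha> (A, M)) = fst (\<alpha> (A, 0))"
proof -
  have "(A, M) = (mat 1, M) \<otimes>\<^bsub>G\<^esub> (A, 0)"
    by (simp add: G_def)
  then have "\<alpha> (A, M) = \<alpha> (mat 1, M) \<otimes>\<^bsub>G\<^esub> \<alpha> (A, 0)"
    using \<alpha>_mult[of "(mat 1, M)" "(A, 0)"] assms by (simp add: carrier_iff)
  moreover have "fst (\<alpha> (mat 1, M)) = mat 1"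
    using fst_\<alpha>_eq_one_iff[of "(mat 1, M)"] by (simp add: carrier_iff)
  ultimately show ?thesis
    by (simp add: G_def)
qed

text \<open>The induced map \<open>?\<beta>\<close> on the quotient is computed on the
  representatives (A, 0). Its kernel is trivial because only the matrix subgroup maps into itself,
  and for surjectivity the matrix part of a preimage may be dropped.\<close>

lemma aut_equiv_fst:
  assumes "x \<in> carrier G"
  shows "aut_equiv SL2 (fst x) (fst (\<alpha> x))"
proof -
  let ?\<beta> = "\<lambda>A. fst (\<alpha> (A, 0))"
  have hom: "?\<beta> \<in> hom SL2 SL2"
  proof (rule homI)
    fix A B :: "'a ^ 2 ^ 2"
    assume "A \<in> carrier SL2"
    then have A: "(A, 0) \<in> carrier G"
      by (simp add: carrier_iff)
    then show "?\<beta> A \<in> carrier SL2"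
      using \<alpha>_closed[OF A] by (simp add: carrier_iff)
    assume "B \<in> carrier SL2"
    then have "(B, 0) \<in> carrier G"
      by (simp add: carrier_iff)
    from \<alpha>_mult[OF A this] show "?\<beta> (A \<otimes>\<^bsub>SL2\<^esub> B) = ?\<beta> A \<otimes>\<^bsub>SL2\<^esub> ?\<beta> B"
      by (simp add: G_def)
  qed
  then interpret group_hom SL2 SL2 ?\<beta>
    by (simp add: group_hom_def group_hom_axioms_def group_SL2)
  have "inj_on ?\<beta> (carrier SL2)"
    unfolding inj_on_one_iff using fst_\<alpha>_eq_one_iff by (simp add: carrier_iff)
  moreover have "carrier SL2 \<subseteq> ?\<beta> ` carrier SL2"
  proof
    fix B :: "'a ^ 2 ^ 2" assume "B \<in> carrier SL2"
    then have "(B, 0) \<in> \<alpha> ` carrier G"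
      by (simp add: carrier_iff flip: \<alpha>_image)
    then obtain A M where "(B, 0) = \<alpha> (A, M)" "det A = 1"
      by (auto simp: carrier_iff)
    then have "B = ?\<beta> A" "A \<in> carrier SL2"
      using fst_\<alpha>_eq[of A M] by (metis fst_conv, simp)
    then show "B \<in> ?\<beta> ` carrier SL2"
      by (rule image_eqI)
  qed
  ultimately have "bij_betw ?\<beta> (carrier SL2) (carrier SL2)"
    unfolding bij_betw_def using hom_in_carrier[OF hom] by blast
  from group.aut_equivI[OF group_SL2 hom this, of "fst x"] show ?thesis
    using assms fst_\<alpha>_eq[of "fst x" "snd x"] by (simp add: carrier_iff)
qed

end

section \<open>A complete invariant of the orbits\<close>

text \<open>
  The values \<open>Inl 0\<close>, \<open>Inl 1\<close> and \<open>Inl 2\<close> stand for rank one, rank two and order four. They are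
  expressed through \<open>N\<close> and the group operation to make their invariance evident.
\<close>

definition orbit_invariant ::
    "('a::field ^ 2 ^ 2) \<times> ('a ^ 'm::finite ^ 2) \<Rightarrow> nat + ('a ^ 2 ^ 2) set" where
  "orbit_invariant x =
    (let G = SL2_semidirect_matrices in
     if fst x = mat 1 \<and> x \<noteq> \<one>\<^bsub>G\<^esub> then
       (if \<forall>y\<in>carrier G. x \<otimes>\<^bsub>G\<^esub> y = y \<otimes>\<^bsub>G\<^esub> x \<longrightarrow> fst y = mat 1 then Inl 1 else Inl 0)
     else if fst x \<noteq> mat 1 \<and> fst (x \<otimes>\<^bsub>G\<^esub> x) = mat 1 \<and> x \<otimes>\<^bsub>G\<^esub> x \<noteq> \<one>\<^bsub>G\<^esub> then Inl 2
     else Inr (aut_orbit SL2 (fst x)))"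

text \<open>Every clause of the definition is preserved by \<open>\<alpha>\<close>; for the
  quantified one, \<open>y\<close> is reindexed along the bijection \<open>\<alpha>\<close> of the
  carrier.\<close>

lemma (in SL2_extension_automorphism) orbit_invariant_\<alpha>:
  assumes x: "x \<in> carrier G"
  shows "orbit_invariant (\<alpha> x) = orbit_invariant x"
proof -
  have "aut_orbit SL2 (fst (\<alpha> x)) = aut_orbit SL2 (fst x)"
    using aut_equiv_fst[OF x] group.aut_orbit_eq_iff[OF group_SL2, of "fst x" "fst (\<alpha> x)"]
      x \<alpha>_closed[OF x] by (simp add: carrier_iff)
  moreover have "(\<forall>y\<in>carrier G. \<alpha> x \<otimes>\<^bsub>G\<^esub> y = y \<otimes>\<^bsub>G\<^esub> \<alpha> x \<longrightarrow> fst y = mat 1) \<longleftrightarrow>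
      (\<forall>y\<in>\<alpha> ` carrier G. \<alpha> x \<otimes>\<^bsub>G\<^esub> y = y \<otimes>\<^bsub>G\<^esub> \<alpha> x \<longrightarrow> fst y = mat 1)"
    by (simp only: \<alpha>_image[symmetric])
  then have "(\<forall>y\<in>carrier G. \<alpha> x \<otimes>\<^bsub>G\<^esub> y = y \<otimes>\<^bsub>G\<^esub> \<alpha> x \<longrightarrow> fst y = mat 1) \<longleftrightarrow>
      (\<forall>y\<in>carrier G. x \<otimes>\<^bsub>G\<^esub> y = y \<otimes>\<^bsub>G\<^esub> x \<longrightarrow> fst y = mat 1)"
    using x by (simp add: \<alpha>_eq_iff mult_closed fst_\<alpha>_eq_one_iff flip: \<alpha>_mult)
  moreover have "fst (\<alpha> x) = mat 1 \<longleftrightarrow> fst x = mat 1" "\<alpha> x = \<one>\<^bsub>G\<^esub> \<longleftrightarrow> x = \<one>\<^bsub>G\<^esub>"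
    using x by (simp_all add: fst_\<alpha>_eq_one_iff \<alpha>_eq_one_iff)
  moreover have "fst (\<alpha> x \<otimes>\<^bsub>G\<^esub> \<alpha> x) = mat 1 \<longleftrightarrow> fst (x \<otimes>\<^bsub>G\<^esub> x) = mat 1"
    "\<alpha> x \<otimes>\<^bsub>G\<^esub> \<alpha> x = \<one>\<^bsub>G\<^esub> \<longleftrightarrow> x \<otimes>\<^bsub>G\<^esub> x = \<one>\<^bsub>G\<^esub>"
    using x fst_\<alpha>_eq_one_iff[OF mult_closed[OF x x]] \<alpha>_eq_one_iff[OF mult_closed[OF x x]]
    by (simp_all only: \<alpha>_mult)
  ultimately show ?thesis
    unfolding orbit_invariant_def Let_def G_def[symmetric] by (simp only:)
qed

text \<open>The elements (1, M) and (A, N) commute exactly if A M = M, so the centralizer condition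
  is triviality of the stabilizer of \<open>M\<close>.\<close>

lemma commutes_only_with_matrices_iff:
  fixes M :: "'a::field ^ 'm::finite ^ 2"
  shows "(\<forall>y\<in>carrier SL2_semidirect_matrices. (mat 1 :: 'a ^ 2 ^ 2, M) \<otimes>\<^bsub>SL2_semidirect_matrices\<^esub> y =
      y \<otimes>\<^bsub>SL2_semidirect_matrices\<^esub> (mat 1, M) \<longrightarrow> fst y = mat 1) \<longleftrightarrow>
    (\<forall>A. det A = 1 \<longrightarrow> A ** M = M \<longrightarrow> A = mat 1)"
proof -
  have "(mat 1 :: 'a ^ 2 ^ 2, M) \<otimes>\<^bsub>SL2_semidirect_matrices\<^esub> y = y \<otimes>\<^bsub>SL2_semidirect_matrices\<^esub> (mat 1, M)
      \<longleftrightarrow> fst y ** M = M" for y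
    by (cases y) (auto simp: add.commute)
  then show ?thesis
    by (auto simp: Ball_def split_paired_All)
qed

lemma orbit_invariant_simps:
  fixes M :: "'a::field ^ 'm::finite ^ 2" and A :: "'a ^ 2 ^ 2"
  shows "M \<noteq> 0 \<Longrightarrow> orbit_invariant (mat 1 :: 'a ^ 2 ^ 2, M) =
      (if \<forall>A. det A = 1 \<longrightarrow> A ** M = M \<longrightarrow> A = mat 1 then Inl 1 else Inl 0)"
    and "orbit_invariant (mat 1, 0 :: 'a ^ 'm ^ 2) = Inr (aut_orbit SL2 (mat 1 :: 'a ^ 2 ^ 2))"
    and "A \<noteq> mat 1 \<Longrightarrow> orbit_invariant (A, M) =
      (if A ** A = mat 1 \<and> M + A ** M \<noteq> 0 then Inl 2 else Inr (aut_orbit SL2 A))"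
  using commutes_only_with_matrices_iff[of M]
  by (simp_all add: orbit_invariant_def Let_def)

lemma orbit_invariant_eq:
  fixes x y :: "('a::field ^ 2 ^ 2) \<times> ('a ^ 'm::finite ^ 2)"
  assumes char: "CHAR('a) = 2" and large: "infinite (UNIV :: 'a set) \<or> CARD('a) > 2"
    and "aut_equiv SL2_semidirect_matrices x y" "det (fst x) = 1"
  shows "orbit_invariant y = orbit_invariant x"
proof -
  obtain \<alpha> where \<alpha>: "\<alpha> \<in> auto SL2_semidirect_matrices" "\<alpha> x = y"
    using assms by (auto simp: aut_equiv_def)
  interpret SL2_extension_automorphism SL2_semidirect_matrices \<alpha>
    by unfold_locales (use char large \<alpha> in auto)
  show ?thesis
    using orbit_invariant_\<alpha>[of x] assms(4) \<alpha>(2) by simp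
qed

text \<open>The square of this element has matrix part with rows \<open>w\<close> and 0.\<close>

lemma orbit_invariant_transvection:
  fixes w :: "'a::field ^ 'm::finite"
  assumes "CHAR('a) = 2"
  shows "orbit_invariant (mat2 1 1 0 1, second_row w) =
    (if w = 0 then Inr (aut_orbit SL2 (mat2 1 1 0 1)) else Inl 2)"
proof -
  have "second_row w + mat2 1 1 0 1 ** second_row w = 0 \<longleftrightarrow> w = 0"
    using char2_simps[OF assms] by (auto simp: rows2_eq_iff mat2_mult_nth vec_eq_iff)
  then show ?thesis
    using char2_simps[OF assms] by (simp add: orbit_invariant_simps mat_1_eq_mat2)
qed

text \<open>Both elements reduce to a transvection with a second row, and invariance of
  \<open>Inl 2\<close> keeps that row nonzero.\<close>

lemma aut_equiv_of_order_four:
  fixes M N :: "'a::field ^ 'm::finite ^ 2" and A B :: "'a ^ 2 ^ 2"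
  assumes char: "CHAR('a) = 2" and large: "infinite (UNIV :: 'a set) \<or> CARD('a) > 2"
    and A: "det A = 1" "orbit_invariant (A, M) = Inl 2"
    and B: "det B = 1" "orbit_invariant (B, N) = Inl 2"
  shows "aut_equiv SL2_semidirect_matrices (A, M) (B, N)"
proof -
  have normal: "\<exists>w. w \<noteq> 0 \<and> aut_equiv SL2_semidirect_matrices (A, M) (mat2 1 1 0 1, second_row w)"
    if A: "det A = 1" "orbit_invariant (A, M) = Inl 2" for A :: "'a ^ 2 ^ 2" and M :: "'a ^ 'm ^ 2"
  proof -
    have "A \<noteq> mat 1"
    proof
      assume "A = mat 1"
      with A(2) show False
        by (cases "M = 0") (simp_all add: orbit_invariant_simps(1,2) split: if_splits)
    qed
    moreover from this have "A ** A = mat 1"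
      using A(2) by (auto simp: orbit_invariant_simps split: if_splits)
    ultimately obtain w
      where w: "aut_equiv SL2_semidirect_matrices (A, M) (mat2 1 1 0 1, second_row w)"
      using involution_normal_form[OF char A(1)] by blast
    have "w \<noteq> 0"
      using orbit_invariant_eq[OF char large w] A
      by (auto simp: orbit_invariant_transvection[OF char] split: if_splits)
    with w show ?thesis by blast
  qed
  obtain v w where v: "v \<noteq> 0"
      "aut_equiv SL2_semidirect_matrices (A, M) (mat2 1 1 0 1, second_row v)"
    and w: "w \<noteq> 0"
      "aut_equiv SL2_semidirect_matrices (B, N) (mat2 1 1 0 1, second_row w)"
    using normal[OF A] normal[OF B] by blast
  have "aut_equiv SL2_semidirect_matrices (mat2 1 1 0 1, second_row v) (mat2 1 1 0 1, second_row w)"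
    using aut_equiv_second_row[OF v(1) w(1)] by simp
  from semidirect_aut_equiv_trans[OF semidirect_aut_equiv_trans[OF v(2) this]
      semidirect_aut_equiv_sym[OF w(2)]] A(1) B(1)
  show ?thesis by simp
qed

text \<open>For \<open>A = mat 1\<close> the value \<open>Inr U\<close> forces \<open>M = 0\<close>,
  and for A^2 different from 1 a shift suffices. If \<open>A\<close> is a transvection, (A, M) and
  (A, 0) share a normal form.\<close>

lemma aut_equiv_complement:
  fixes M :: "'a::field ^ 'm::finite ^ 2" and A :: "'a ^ 2 ^ 2"
  assumes char: "CHAR('a) = 2" and large: "infinite (UNIV :: 'a set) \<or> CARD('a) > 2"
    and A: "det A = 1" "orbit_invariant (A, M) = Inr U"
  shows "aut_equiv SL2_semidirect_matrices (A, M) (A, 0)" "U = aut_orbit SL2 A"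
proof -
  have refl: "aut_equiv SL2_semidirect_matrices (A, M) (A, M)"
    by (rule group.aut_equiv_refl[OF group_SL2_semidirect_matrices]) (simp add: A)
  have "aut_equiv SL2_semidirect_matrices (A, M) (A, 0) \<and> U = aut_orbit SL2 A"
  proof (cases "A = mat 1")
    case True
    have "M = 0"
    proof (rule ccontr)
      assume "M \<noteq> 0"
      with A(2) True show False
        by (simp add: orbit_invariant_simps(1) split: if_splits)
    qed
    then show ?thesis
      using A(2) refl True by (simp add: orbit_invariant_simps(2))
  next
    case False
    note inv = orbit_invariant_simps(3)[OF False]
    have U: "U = aut_orbit SL2 A"
      using A(2) by (auto simp: inv split: if_splits)
    show ?thesis
    proof (cases "A ** A = mat 1")
      case True
      \<comment> \<open>The hypothesis on \<open>N\<close> says that (A, N) is an involution; a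
        nonzero row in the normal form would give it the value \<open>Inl 2\<close>.\<close>
      have normal: "aut_equiv SL2_semidirect_matrices (A, N) (mat2 1 1 0 1, second_row 0)"
        if N: "N + A ** N = 0" for N :: "'a ^ 'm ^ 2"
      proof -
        obtain w where w: "aut_equiv SL2_semidirect_matrices (A, N) (mat2 1 1 0 1, second_row w)"
          using involution_normal_form[OF char A(1) True False] .
        have "w = 0"
          using orbit_invariant_eq[OF char large w] A(1) N
          by (auto simp: orbit_invariant_transvection[OF char] inv split: if_splits)
        with w show ?thesis by simp
      qed
      have "M + A ** M = 0"
        using A(2) True by (auto simp: inv split: if_splits)
      from semidirect_aut_equiv_trans[OF normal[OF this]
          semidirect_aut_equiv_sym[OF normal[of 0]]] U A(1)
      show ?thesis by simp
    qed (use U aut_equiv_not_involution[OF char A(1)] in blast)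
  qed
  then show "aut_equiv SL2_semidirect_matrices (A, M) (A, 0)" "U = aut_orbit SL2 A"
    by blast+
qed

lemma aut_equiv_of_orbit_invariant:
  fixes x y :: "('a::field ^ 2 ^ 2) \<times> ('a ^ 'm::finite ^ 2)"
  assumes char: "CHAR('a) = 2" and large: "infinite (UNIV :: 'a set) \<or> CARD('a) > 2"
    and det: "det (fst x) = 1" "det (fst y) = 1"
    and eq: "orbit_invariant x = orbit_invariant y"
  shows "aut_equiv SL2_semidirect_matrices x y"
proof -
  obtain A M B N where x: "x = (A, M)" and y: "y = (B, N)"
    by (cases x; cases y) blast
  have A: "det A = 1" and B: "det B = 1"
    using det by (simp_all add: x y)
  \<comment> \<open>A left value other than 2 occurs only in the matrix subgroup, and comparison
    with 1 then tells rank two from rank one.\<close>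
  have one: "A = mat 1 \<and> M \<noteq> 0 \<and>
      (n = 1 \<longleftrightarrow> (\<forall>B. det B = 1 \<longrightarrow> B ** M = M \<longrightarrow> B = mat 1))"
    if "orbit_invariant (A, M) = Inl n" "n \<noteq> 2" for n and A :: "'a ^ 2 ^ 2" and M :: "'a ^ 'm ^ 2"
  proof (cases "A = mat 1")
    case True
    with that(1) have "M \<noteq> 0"
      by (auto simp: orbit_invariant_simps(2))
    with True that(1) show ?thesis
      by (auto simp: orbit_invariant_simps(1) split: if_splits)
  qed (use that in \<open>auto simp: orbit_invariant_simps(3) split: if_splits\<close>)
  show ?thesis
  proof (cases "orbit_invariant x")
    case (Inl n)
    then have n: "orbit_invariant (A, M) = Inl n" "orbit_invariant (B, N) = Inl n"
      using eq by (simp_all add: x y)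
    show ?thesis
    proof (cases "n = 2")
      case True
      then show ?thesis
        using aut_equiv_of_order_four[OF char large A _ B] n by (simp add: x y)
    next
      case False
      note M = one[OF n(1) False] and N = one[OF n(2) False]
      show ?thesis
      proof (cases "n = 1")
        case True
        with M N aut_equiv_of_rank_two[OF char, of M N] show ?thesis
          unfolding x y by blast
      next
        case False
        then show ?thesis
          using aut_equiv_of_rank_one[of M _ N] M N by (auto simp: x y)
      qed
    qed
  next
    case (Inr U)
    then have U: "orbit_invariant (A, M) = Inr U" "orbit_invariant (B, N) = Inr U"
      using eq by (simp_all add: x y)
    note M = aut_equiv_complement[OF char large A U(1)]
    note N = aut_equiv_complement[OF char large B U(2)]
    have "aut_equiv SL2 A B"
      using M(2) N(2) A B group.aut_orbit_eq_iff[OF group_SL2, of A B] by simp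
    from semidirect_aut_equiv_trans[OF semidirect_aut_equiv_trans[OF M(1)
          aut_equiv_SL2_lift[OF char this A]]
        semidirect_aut_equiv_sym[OF N(1)]]
    show ?thesis
      using A B by (simp add: x y)
  qed
qed

text \<open>All three left values must be attained. Two distinct column indices supply the rank two
  witness.\<close>

lemma orbit_invariant_image:
  assumes char: "CHAR('a::field) = 2" and cols: "CARD('m::finite) \<ge> 2"
  shows "orbit_invariant ` carrier (SL2_semidirect_matrices :: (('a ^ 2 ^ 2) \<times> ('a ^ 'm ^ 2)) monoid) =
    {..<3} <+> aut_orbits (SL2 :: ('a ^ 2 ^ 2) monoid)" (is "?I = ?T")
proof
  show "?I \<subseteq> ?T"
    by (auto simp: orbit_invariant_def Let_def aut_orbits_image)
  have mem: "orbit_invariant (A, M) \<in> ?I" if "det A = 1" for A :: "'a ^ 2 ^ 2" and M :: "'a ^ 'm ^ 2"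
    using that by (intro imageI) simp
  obtain k l :: 'm where kl: "k \<noteq> l"
  proof (rule ccontr)
    assume "\<not> thesis"
    then have "UNIV \<subseteq> {undefined :: 'm}"
      using that by blast
    then have "CARD('m) \<le> 1"
      using card_mono[of "{undefined :: 'm}" UNIV] by simp
    with cols show False by simp
  qed
  let ?e = "\<lambda>i. axis i 1 :: 'a ^ 'm"
  have e: "?e k $ k = 1" "?e l $ l = 1" "?e k $ l = 0" "?e l $ k = 0"
    using kl by (simp_all add: axis_def)
  have "?e k \<noteq> 0"
    using e(1) by (metis zero_index zero_neq_one)
  have 0: "Inl 0 \<in> ?I"
  proof -
    have "second_row (?e k) \<noteq> 0"
      using \<open>?e k \<noteq> 0\<close> by (simp add: rows2_eq_iff)
    moreover have "\<not> (\<forall>A. det A = 1 \<longrightarrow> A ** second_row (?e k) = second_row (?e k) \<longrightarrow> A = mat 1)"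
      by (auto simp: rows2_eq_iff[of _ "second_row (?e k)"] mat2_mult_nth mat_1_eq_mat2
        intro!: exI[of _ "mat2 1 0 1 1"])
    ultimately have "orbit_invariant (mat 1 :: 'a ^ 2 ^ 2, second_row (?e k)) = Inl 0"
      by (simp only: orbit_invariant_simps(1) if_False simp_thms)
    then show ?thesis
      using mem[of "mat 1" "second_row (?e k)"] by simp
  qed
  have 1: "Inl 1 \<in> ?I"
  proof -
    \<comment> \<open>The rows are distinct unit vectors, so A M = M determines every entry of
      \<open>A\<close>.\<close>
    define M where "M = (vector [?e k, ?e l] :: 'a ^ 'm ^ 2)"
    have M: "M $ 1 = ?e k" "M $ 2 = ?e l"
      by (simp_all add: M_def)
    then have "M \<noteq> 0"
      using \<open>?e k \<noteq> 0\<close> by auto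
    moreover have "A = mat 1" if "A ** M = M" for A
    proof -
      obtain a b c d where A: "A = mat2 a b c d" by (rule mat2_cases)
      have "a *s ?e k + b *s ?e l = ?e k" "c *s ?e k + d *s ?e l = ?e l"
        using that by (simp_all add: A rows2_eq_iff mat2_mult_nth M)
      then have "(a *s ?e k + b *s ?e l) $ i = ?e k $ i" "(c *s ?e k + d *s ?e l) $ i = ?e l $ i" for i
        by simp_all
      from this[of k] this[of l] show ?thesis
        by (simp add: A mat_1_eq_mat2 e)
    qed
    ultimately show ?thesis
      using mem[of "mat 1" M] by (simp add: orbit_invariant_simps(1))
  qed
  have 2: "Inl 2 \<in> ?I"
    using mem[of "mat2 1 1 0 1" "second_row (?e k)"] \<open>?e k \<noteq> 0\<close>
    by (simp add: orbit_invariant_transvection[OF char])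
  have "Inr (aut_orbit SL2 A) \<in> ?I" if "det A = 1" for A
    using mem[OF that, of 0] by (cases "A = mat 1") (simp_all add: orbit_invariant_simps(2,3))
  moreover have "{..<3} = {0, 1, 2 :: nat}"
    by auto
  ultimately show "?T \<subseteq> ?I"
    using 0 1 2 by (auto simp: aut_orbits_image)
qed

theorem theorem3:
  assumes "CHAR('a::field) = 2"
    and "infinite (UNIV :: 'a set) \<or> CARD('a) > 2"
    and "CARD('m::finite) \<ge> 2"
  shows "\<omega> (SL2_semidirect_matrices :: (('a ^ 2 ^ 2) \<times> ('a ^ 'm ^ 2)) monoid)
    =o |{..<3::nat}| +c \<omega> (SL2 :: ('a ^ 2 ^ 2) monoid)"
proof -
  let ?G = "SL2_semidirect_matrices :: (('a ^ 2 ^ 2) \<times> ('a ^ 'm ^ 2)) monoid"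
  \<comment> \<open>The orbit map and the invariant have the same fibres: invariance gives one
    direction, completeness the other.\<close>
  have "|aut_orbit ?G ` carrier ?G| =o |orbit_invariant ` carrier ?G|"
  proof (rule card_of_image_ordIso)
    fix x y assume xy: "x \<in> carrier ?G" "y \<in> carrier ?G"
    then have det: "det (fst x) = 1" "det (fst y) = 1"
      by simp_all
    have "aut_equiv ?G x y \<longleftrightarrow> orbit_invariant x = orbit_invariant y"
      using orbit_invariant_eq[OF assms(1,2) _ det(1)] aut_equiv_of_orbit_invariant[OF assms(1,2) det]
      by metis
    then show "aut_orbit ?G x = aut_orbit ?G y \<longleftrightarrow> orbit_invariant x = orbit_invariant y"
      using group.aut_orbit_eq_iff[OF group_SL2_semidirect_matrices xy] by (rule trans[rotated])
  qed
  then show ?thesis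
    unfolding orbit_invariant_image[OF assms(1,3)] aut_orbits_image[symmetric]
    by (simp add: aut_orbit_number_def csum_def Field_card_of)
qed

end
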